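(* Let $g$ be a totally positive function of Gaussian type. Let $f\in V^\infty(g)\setminus\{0\}$ be real-valued and let $(N_f,m_f)$ be its set of real zeros counted with multiplicities. Then $D^-(N_f,m_f)\le1$. In particular, if $\Lambda\subseteq\mathbb{R}$ satisfies $D^-(\Lambda)>1$, then $\Lambda$ is a uniqueness set for $V^\infty(g)$, i.e. every $f\in V^\infty(g)$ vanishing on $\Lambda$ is identically zero.
   Context: $g$ is totally positive of Gaussian type if $\hat g(\xi)=\prod_{j=1}^n(1+2\pi i\delta_j\xi)^{-1}e^{-c\xi^2}$ with $\delta_j\in\mathbb{R}$, $c>0$, $n\in\mathbb{N}\cup\{0\}$ (Fourier transform $\hat g(\xi)=\int g(x)e^{-2\pi ix\xi}dx$). $V^\infty(g)=\{\sum_{k\in\mathbb{Z}}c_kg(\cdot-k):c\in\ell^\infty(\mathbb{Z})\}$. $m_f(x)$ is the order of vanishing of $f$ at a zero $x$. $D^-(N,m)=\liminf_{r\to\infty}\inf_{x\in\mathbb{R}}\frac{1}{2r}\sum_{\lambda\in N\cap[x-r,x+r]}m(\lambda)$, and $D^-(\Lambda)$ is this with $m\equiv1$. *)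

theory Defs
  imports "HOL-Analysis.Analysis"
begin

definition fourier :: "(real \<Rightarrow> real) \<Rightarrow> real \<Rightarrow> complex" where
  "fourier g \<xi> = integral\<^sup>L lborel (\<lambda>x. complex_of_real (g x) * cis (- 2 * pi * x * \<xi>))"

definition TP_gaussian_type :: "(real \<Rightarrow> real) \<Rightarrow> bool" where
  "TP_gaussian_type g \<longleftrightarrow> continuous_on UNIV g \<and> integrable lborel g \<and>
     (\<exists>(n::nat) (\<delta>::nat \<Rightarrow> real) (c::real). c > 0 \<and>
        (\<forall>\<xi>. fourier g \<xi> =
           (\<Prod>j<n. inverse (1 + 2 * pi * \<i> * complex_of_real (\<delta> j * \<xi>)))
           * complex_of_real (exp (- c * \<xi>\<^sup>2))))"

definition V_infty :: "(real \<Rightarrow> real) \<Rightarrow> (real \<Rightarrow> complex) set" where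
  "V_infty g = {f. \<exists>c::int \<Rightarrow> complex. bounded (range c) \<and>
       (\<forall>x. f x = (\<Sum>\<^sub>\<infinity>k\<in>UNIV. c k * complex_of_real (g (x - real_of_int k))))}"

definition vanishing_order :: "(real \<Rightarrow> real) \<Rightarrow> real \<Rightarrow> nat" where
  "vanishing_order f x = (LEAST n. (deriv ^^ n) f x \<noteq> 0)"

definition weighted_count :: "real set \<Rightarrow> (real \<Rightarrow> nat) \<Rightarrow> real set \<Rightarrow> ereal" where
  "weighted_count N m I =
     (if finite (N \<inter> I) then ereal (\<Sum>y\<in>N \<inter> I. real (m y)) else \<infinity>)"

definition lower_density :: "real set \<Rightarrow> (real \<Rightarrow> nat) \<Rightarrow> ereal" where
  "lower_density N m =
     Liminf at_top (\<lambda>r::real. INF x. weighted_count N m {x - r .. x + r} / ereal (2 * r))"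

definition lower_density_set :: "real set \<Rightarrow> ereal" where
  "lower_density_set \<Lambda> = lower_density \<Lambda> (\<lambda>_. 1)"

end

theory Submission
  imports Defs "HOL-Probability.Probability" "HOL-Complex_Analysis.Complex_Analysis"
begin

text \<open>
  By uniqueness of the Fourier transform, \<open>g\<close> arises from a Gaussian \<open>\<phi>\<close> by applying the inverses of the
  operators \<open>I + \<delta>\<^sub>j D\<close>, each of which is an average of translates over the exponential distribution.
  Hence \<open>f = \<Sum> c\<^sub>k g(\<cdot> - k)\<close> arises in the same way from \<open>h = \<Sum> c\<^sub>k \<phi>(\<cdot> - k)\<close>. Since
  \<open>f + \<delta> f' = \<delta> e\<^bsup>-x/\<delta>\<^esup> (e\<^bsup>x/\<delta>\<^esup> f)'\<close>, Rolle's theorem shows that each operator \<open>I + \<delta>\<^sub>j D\<close> loses at most one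
  zero per interval, so the zeros of \<open>h\<close> are at least as dense as those of \<open>f\<close>.

  For the Gaussian \<open>e\<^bsup>-a x\<^sup>2\<^esup>\<close> write \<open>h(x) = e\<^bsup>-a x\<^sup>2\<^esup> P(e\<^bsup>2 a x\<^esup>)\<close> with a Laurent series \<open>P\<close> satisfying
  \<open>|P(w)| \<le> C e\<^bsup>a x\<^sup>2\<^esup>\<close> for \<open>|w| = e\<^bsup>2 a x\<^esup>\<close>. If \<open>h\<close> has at least \<open>M > L\<close> zeros in each of the intervals
  \<open>[k L, (k + 1) L]\<close>, divide \<open>P\<close> by the zeros coming from \<open>-n \<le> k < n\<close> and apply the maximum principle on
  the annulus \<open>e\<^bsup>-2 a n L\<^esup> \<le> |w| \<le> e\<^bsup>2 a n L\<^esup>\<close>. This gives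
  \<open>|P(w)| \<le> e\<^bsup>-a L (M - L) n\<^sup>2 + O(n)\<^esup>\<close> for every \<open>n\<close>, hence \<open>P = 0\<close>.
\<close>

section \<open>Zeros counted with multiplicity\<close>

text \<open>Here \<^term>\<open>u i\<close> stands for the \<^term>\<open>i\<close>-th derivative of \<^term>\<open>u 0\<close>. Multiplicities are
  only bounded from below, so a point where all derivatives vanish causes no trouble.\<close>

definition has_zeros :: "(nat \<Rightarrow> real \<Rightarrow> real) \<Rightarrow> nat \<Rightarrow> real set \<Rightarrow> bool" where
  "has_zeros u N I \<longleftrightarrow>
     (\<exists>Z. size Z = N \<and> set_mset Z \<subseteq> I \<and> (\<forall>y. \<forall>i<count Z y. u i y = 0))"

lemma has_zeros_Suc_D:
  assumes "has_zeros u (Suc N) I"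
  shows "has_zeros u N I"
proof -
  from assms obtain Z where Z: "size Z = Suc N" "set_mset Z \<subseteq> I" "\<forall>y. \<forall>i<count Z y. u i y = 0"
    unfolding has_zeros_def by blast
  from Z(1) obtain p Z' where Z': "Z = add_mset p Z'"
    by (metis size_eq_Suc_imp_eq_union)
  show ?thesis
    unfolding has_zeros_def
  proof (intro exI[of _ Z'] conjI allI impI)
    fix y i assume "i < count Z' y"
    then have "i < count Z y" using Z' by auto
    then show "u i y = 0" using Z(3) by blast
  qed (use Z Z' in auto)
qed

lemma has_zeros_mono:
  assumes "has_zeros u N I" "M \<le> N"
  shows "has_zeros u M I"
  using assms(2,1) by (induction rule: inc_induct) (auto dest: has_zeros_Suc_D)

text \<open>The integrating factor \<open>exp (x / d)\<close> makes \<open>f + d * f'\<close> a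
  derivative up to a nonvanishing factor, for either sign of \<open>d\<close>; Rolle's theorem then
  applies.\<close>

lemma rolle_add_deriv:
  fixes f f' :: "real \<Rightarrow> real"
  assumes der: "\<And>x. (f has_real_derivative f' x) (at x)"
    and "d \<noteq> 0" "a < b" "f a = 0" "f b = 0"
  shows "\<exists>x. a < x \<and> x < b \<and> f x + d * f' x = 0"
proof -
  have der': "((\<lambda>x. exp (x / d) * f x) has_real_derivative exp (x / d) * (f x + d * f' x) / d) (at x)" for x
    by (rule derivative_eq_intros der refl | use \<open>d \<noteq> 0\<close> in \<open>simp add: field_simps\<close>)+
  have "\<exists>z. a < z \<and> z < b \<and> DERIV (\<lambda>x. exp (x / d) * f x) z :> 0"
  proof (rule Rolle)
    show "continuous_on {a..b} (\<lambda>x. exp (x / d) * f x)"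
      by (intro DERIV_continuous_on) (rule DERIV_subset[OF der'], simp)
    show "\<And>x. a < x \<Longrightarrow> x < b \<Longrightarrow> (\<lambda>x. exp (x / d) * f x) differentiable at x"
      using der' real_differentiable_def by blast
  qed (use assms in auto)
  then obtain z where z: "a < z" "z < b" "DERIV (\<lambda>x. exp (x / d) * f x) z :> 0" by blast
  then have "exp (z / d) * (f z + d * f' z) / d = 0"
    using der' DERIV_unique by blast
  then show ?thesis using z \<open>d \<noteq> 0\<close> by auto
qed

text \<open>The new sequence is again a function with its successive derivatives, so the step can be
  iterated. A zero of multiplicity m survives with multiplicity m - 1, since order i involves only
  \<open>u i\<close> and \<open>u (Suc i)\<close>.\<close>

lemma has_zeros_add_deriv:
  assumes der: "\<And>i x. (u i has_real_derivative u (Suc i) x) (at x)"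
    and zeros: "has_zeros u (Suc N) {a..b}"
  shows "has_zeros (\<lambda>i x. u i x + d * u (Suc i) x) N {a..b}"
proof (cases "d = 0")
  case True
  then show ?thesis using has_zeros_Suc_D[OF zeros] by simp
next
  case False
  from zeros obtain Z where Z: "size Z = Suc N" "set_mset Z \<subseteq> {a..b}"
    and Z0: "\<And>y i. i < count Z y \<Longrightarrow> u i y = 0"
    unfolding has_zeros_def by blast
  define S where "S = set_mset Z"
  \<comment> \<open>Every multiplicity drops by one, and each of the \<open>card S - 1\<close> gaps contributes a new simple zero.\<close>
  define nxt where "nxt y = Min {y'\<in>S. y < y'}" for y
  have finS: "finite S" and neS: "S \<noteq> {}" using Z(1) by (auto simp: S_def)
  have S0: "u 0 y = 0" if "y \<in> S" for y
    using Z0[of 0 y] that by (simp add: S_def)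
  define S' where "S' = S - {Max S}"
  have nxt: "nxt y \<in> S" "y < nxt y" "\<And>z. z \<in> S \<Longrightarrow> y < z \<Longrightarrow> nxt y \<le> z" if "y \<in> S'" for y
  proof -
    have "y \<le> Max S" "y \<noteq> Max S" using that finS by (auto simp: S'_def)
    then have "Max S \<in> {y'\<in>S. y < y'}" using finS neS by auto
    then have "nxt y \<in> {y'\<in>S. y < y'}" unfolding nxt_def using finS by (intro Min_in) auto
    then show "nxt y \<in> S" "y < nxt y" by auto
    show "nxt y \<le> z" if "z \<in> S" "y < z" for z
      unfolding nxt_def using finS that by (intro Min_le) auto
  qed
  have "\<exists>x. y < x \<and> x < nxt y \<and> u 0 x + d * u (Suc 0) x = 0" if "y \<in> S'" for y
    using that nxt[OF that] S0 by (intro rolle_add_deriv[OF der False]) (auto simp: S'_def)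
  then obtain \<xi> where \<xi>: "\<And>y. y \<in> S' \<Longrightarrow> y < \<xi> y \<and> \<xi> y < nxt y \<and> u 0 (\<xi> y) + d * u (Suc 0) (\<xi> y) = 0"
    by metis
  have less: "\<xi> y < \<xi> z" if "y \<in> S'" "z \<in> S'" "y < z" for y z
    using \<xi>[OF that(1)] \<xi>[OF that(2)] nxt(3)[OF that(1), of z] that by (auto simp: S'_def)
  have inj: "inj_on \<xi> S'"
    by (rule inj_onI) (metis less linorder_neqE_linordered_idom less_irrefl)
  \<comment> \<open>The Rolle points are not old zeros, so the two summands of \<open>Z'\<close>
    have disjoint supports and can be checked separately.\<close>
  have disj: "\<xi> y \<notin> S" if "y \<in> S'" for y
    using \<xi>[OF that] nxt(3)[OF that, of "\<xi> y"] by auto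
  define X where "X = mset_set (\<xi> ` S')"
  \<comment> \<open>Its size is (N + 1) - card S + (card S - 1) = N.\<close>
  define Z' where "Z' = (Z - mset_set S) + X"
  have finS': "finite S'" using finS by (simp add: S'_def)
  have sub: "mset_set S \<subseteq># Z"
    unfolding S_def by (simp add: mset_set_set_mset_msubset)
  show ?thesis
    unfolding has_zeros_def
  proof (intro exI[of _ Z'] conjI allI impI)
    have "card S' = card S - 1" using finS neS by (simp add: S'_def)
    moreover have "card S \<le> size Z" using size_mset_mono[OF sub] by simp
    moreover have "card S > 0" using finS neS by (simp add: card_gt_0_iff)
    ultimately show "size Z' = N"
      using Z(1) by (simp add: Z'_def X_def size_Diff_submset[OF sub] card_image[OF inj])
    have "\<xi> y \<in> {a..b}" if "y \<in> S'" for y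
    proof -
      have "y \<in> {a..b}" "nxt y \<in> {a..b}" using that nxt(1)[OF that] Z(2) by (auto simp: S'_def S_def)
      with \<xi>[OF that] show ?thesis by auto
    qed
    then show "set_mset Z' \<subseteq> {a..b}"
      using Z(2) finS' by (auto simp: Z'_def X_def dest!: in_diffD)
  next
    fix y i assume i: "i < count Z' y"
    show "u i y + d * u (Suc i) y = 0"
    proof (cases "y \<in> S")
      case True
      then have "y \<notin> \<xi> ` S'" using disj by auto
      then have "i < count Z y - 1"
        using i True finS finS' by (simp add: Z'_def X_def)
      then show ?thesis using Z0[of i y] Z0[of "Suc i" y] by simp
    next
      case False
      then have "count Z y = 0" by (simp add: S_def count_eq_zero_iff)
      then have "i < count X y" using i by (simp add: Z'_def)
      then have "y \<in> \<xi> ` S'" "i = 0" using finS'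
        by (auto simp: X_def count_mset_set' split: if_splits)
      then show ?thesis using \<xi> by auto
    qed
  qed
qed

section \<open>From lower density to zeros in every window\<close>

text \<open>For some q > 1 every window of length 2 r has weight above 2 r q, and the surplus 2 r (q
  - 1) outgrows any constant. Of this surplus, \<open>d\<close> zeros pay for later uses of Rolle's
  theorem, and the 1 in \<open>2 * r + 1\<close> pays for unit gaps between the windows.\<close>

lemma lower_density_gt_1_has_zeros:
  fixes S :: "real set" and m :: "real \<Rightarrow> nat"
  assumes dens: "lower_density S m > 1"
    and zero: "\<And>y. y \<in> S \<Longrightarrow> u 0 y = 0"
    and mult: "\<And>y i. y \<in> S \<Longrightarrow> i < m y \<Longrightarrow> u i y = 0"
  obtains r :: real and M :: nat
  where "r > 0" "real M > 2 * r + 1" "\<And>x. has_zeros u (M + d) {x - r..x + r}"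
proof -
  obtain q where q: "ereal 1 < ereal q" "ereal q < lower_density S m"
    using ereal_dense2[of 1 "lower_density S m"] dens by (metis one_ereal_def)
  have "eventually (\<lambda>r. ereal q < (INF x. weighted_count S m {x - r .. x + r} / ereal (2 * r))) at_top"
    using less_LiminfD q(2) unfolding lower_density_def by blast
  \<comment> \<open>This size of \<open>r\<close> makes the surplus \<open>2 * r * (q - 1)\<close>
    at least \<open>d + 2\<close>.\<close>
  moreover have "eventually (\<lambda>r::real. r \<ge> max 1 ((d + 2) / (2 * (q - 1)))) at_top"
    by (rule eventually_ge_at_top)
  ultimately obtain r where
    r: "ereal q < (INF x. weighted_count S m {x - r .. x + r} / ereal (2 * r))"
       "r \<ge> max 1 ((d + 2) / (2 * (q - 1)))"
    by (metis (mono_tags, lifting) eventually_conj eventually_happens' trivial_limit_at_top_linorder)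
  have r1: "r \<ge> 1" and "(d + 2) / (2 * (q - 1)) \<le> r" using r(2) by auto
  then have rq: "2 * r * q \<ge> 2 * r + 2 + d" using q(1) by (simp add: field_simps)
  \<comment> \<open>The least integer above \<open>2 * r + 1\<close>; it is at most
    \<open>2 * r + 2\<close>, which accounts for the 2 in the threshold for
    \<open>r\<close>.\<close>
  define M where "M = nat (\<lfloor>2 * r + 1\<rfloor> + 1)"
  have M: "real M > 2 * r + 1" "real M \<le> 2 * r + 2" using r1 unfolding M_def by linarith+
  have "has_zeros u (M + d) {x - r..x + r}" for x
  proof (cases "finite (S \<inter> {x - r..x + r})")
    case True
    define F where "F = S \<inter> {x - r..x + r}"
    have finF: "finite F" using True F_def by simp
    have "ereal q < weighted_count S m {x - r..x + r} / ereal (2 * r)"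
      using r(1) by (meson INF_lower UNIV_I less_le_trans)
    also have "\<dots> = ereal ((\<Sum>y\<in>F. real (m y)) / (2 * r))"
      using True r1 by (simp add: weighted_count_def F_def)
    finally have "2 * r * q < (\<Sum>y\<in>F. real (m y))" using r1 by (simp add: field_simps)
    then have *: "M + d \<le> (\<Sum>y\<in>F. m y)"
      using rq M(2) by (simp flip: of_nat_sum of_nat_add)
    define Z where "Z = (\<Sum>y\<in>F. replicate_mset (m y) y)"
    have cZ: "count Z y = (if y \<in> F then m y else 0)" for y
      using finF by (simp add: Z_def count_sum if_distrib sum.delta cong: if_cong)
    have "has_zeros u (\<Sum>y\<in>F. m y) {x - r..x + r}"
      unfolding has_zeros_def
    proof (intro exI[of _ Z] conjI allI impI)
      show "size Z = (\<Sum>y\<in>F. m y)" by (simp add: Z_def size_multiset_sum)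
      show "set_mset Z \<subseteq> {x - r..x + r}"
        using cZ by (auto simp: F_def simp flip: count_greater_zero_iff split: if_splits)
      show "u i y = 0" if "i < count Z y" for y i
        using that mult by (auto simp: cZ F_def split: if_splits)
    qed
    then show ?thesis using * has_zeros_mono by blast
  next
    \<comment> \<open>With infinitely many points in the window, any \<open>M + d\<close> distinct
      ones serve as simple zeros. Here \<open>zero\<close> is used, because \<open>m\<close> may be
      0 at these points.\<close>
    case False
    then obtain F where F: "F \<subseteq> S \<inter> {x - r..x + r}" "finite F" "card F = M + d"
      using infinite_arbitrarily_large by metis
    show ?thesis
      unfolding has_zeros_def
      by (rule exI[of _ "mset_set F"]) (use F zero in \<open>auto simp: count_mset_set' split: if_splits\<close>)
  qed
  then show ?thesis using that[of r M] M r1 by auto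
qed

section \<open>Laurent series with many positive zeros\<close>

text \<open>The order of a zero is expressed by a growth bound along the real axis, because this is what
  Taylor's formula for a real function provides.\<close>

lemma holomorphic_factor_real_zeros:
  fixes P :: "complex \<Rightarrow> complex" and Z :: "real multiset"
  assumes "P holomorphic_on A" "open A" "\<And>p. p \<in># Z \<Longrightarrow> complex_of_real p \<in> A"
    and "\<And>p. p \<in># Z \<Longrightarrow>
           \<exists>B. \<forall>\<^sub>F t in at p. norm (P (complex_of_real t)) \<le> B * \<bar>t - p\<bar> ^ count Z p"
  shows "\<exists>R. R holomorphic_on A \<and> (\<forall>w\<in>A. P w = (\<Prod>p\<in>#Z. w - complex_of_real p) * R w)"
  using assms
proof (induction Z arbitrary: P)
  case empty
  then show ?case by (intro exI[of _ P]) auto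
next
  case (add p Z)
  have pA: "complex_of_real p \<in> A" using add.prems(3) by simp
  obtain B where B: "\<forall>\<^sub>F t in at p. norm (P (complex_of_real t)) \<le> B * \<bar>t - p\<bar> ^ Suc (count Z p)"
    using add.prems(4)[of p] by auto
  have contP: "isCont P (complex_of_real p)"
    using add.prems(1,2) pA continuous_on_eq_continuous_at holomorphic_on_imp_continuous_on by blast
  have lim: "((\<lambda>t. P (complex_of_real t)) \<longlongrightarrow> P (complex_of_real p)) (at p)"
    by (rule isCont_tendsto_compose[OF contP]) (intro tendsto_intros)
  have "((\<lambda>t. P (complex_of_real t)) \<longlongrightarrow> 0) (at p)"
  proof (rule Lim_null_comparison[OF B])
    have "((\<lambda>t. B * \<bar>t - p\<bar> ^ Suc (count Z p)) \<longlongrightarrow> B * \<bar>p - p\<bar> ^ Suc (count Z p)) (at p)"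
      by (intro tendsto_intros)
    then show "((\<lambda>t. B * \<bar>t - p\<bar> ^ Suc (count Z p)) \<longlongrightarrow> 0) (at p)" by simp
  qed
  with lim have P0: "P (complex_of_real p) = 0"
    using tendsto_unique trivial_limit_at by blast
  \<comment> \<open>The difference quotient at \<open>p\<close> with its removable singularity
    filled in. It splits off one factor \<open>w - p\<close>; the growth bounds must now be carried
    over to it.\<close>
  define Q where "Q z = (if z = complex_of_real p then deriv P (complex_of_real p)
                   else (P z - P (complex_of_real p)) / (z - complex_of_real p))" for z
  have holQ: "Q holomorphic_on A"
    unfolding Q_def by (rule pole_lemma_open) (use add.prems in auto)
  have PQ: "P z = (z - complex_of_real p) * Q z" for z
    by (simp add: Q_def P0)
  have normQ: "norm (P (complex_of_real t)) = \<bar>t - p\<bar> * norm (Q (complex_of_real t))" for t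
    by (simp add: PQ norm_mult flip: of_real_diff)
  have "\<exists>R. R holomorphic_on A \<and> (\<forall>w\<in>A. Q w = (\<Prod>p\<in>#Z. w - complex_of_real p) * R w)"
  proof (rule add.IH[OF holQ add.prems(2)])
    show "complex_of_real y \<in> A" if "y \<in># Z" for y using add.prems(3) that by simp
    fix y assume y: "y \<in># Z"
    show "\<exists>B. \<forall>\<^sub>F t in at y. norm (Q (complex_of_real t)) \<le> B * \<bar>t - y\<bar> ^ count Z y"
    proof (cases "y = p")
      \<comment> \<open>At \<open>p\<close> itself one power of \<open>\<bar>t - p\<bar>\<close>
        cancels on the punctured neighbourhood.\<close>
      case True
      have "\<forall>\<^sub>F t in at p. t \<noteq> p" by (simp add: eventually_at_filter)
      with B have "\<forall>\<^sub>F t in at p. norm (Q (complex_of_real t)) \<le> B * \<bar>t - p\<bar> ^ count Z p"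
      proof eventually_elim
        case (elim t)
        then have "\<bar>t - p\<bar> * norm (Q (complex_of_real t)) \<le> \<bar>t - p\<bar> * (B * \<bar>t - p\<bar> ^ count Z p)"
          by (simp add: normQ mult_ac)
        then show ?case using elim(2) by (simp add: mult_le_cancel_left)
      qed
      then show ?thesis using True by blast
    next
      case False
      obtain B' where B': "\<forall>\<^sub>F t in at y. norm (P (complex_of_real t)) \<le> B' * \<bar>t - y\<bar> ^ count Z y"
        using add.prems(4)[of y] y False by auto
      \<comment> \<open>Near another zero \<open>y\<close> the divisor \<open>t - p\<close> stays at
        least half the distance \<open>\<bar>y - p\<bar>\<close>, so the order of growth at
        \<open>y\<close> is unchanged.\<close>
      define D where "D = \<bar>y - p\<bar> / 2"
      have D: "D > 0" using False by (simp add: D_def)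
      have "\<forall>\<^sub>F t in at y. dist t y < D" by (rule eventually_at_ball'[THEN eventually_mono, of D]) (use D in \<open>auto simp: dist_commute\<close>)
      with B' have "\<forall>\<^sub>F t in at y. norm (Q (complex_of_real t)) \<le> (B' / D) * \<bar>t - y\<bar> ^ count Z y"
      proof eventually_elim
        case (elim t)
        have "D \<le> \<bar>t - p\<bar>" using elim(2) unfolding dist_real_def D_def
          by (simp add: abs_if split: if_splits)
        then have "D * norm (Q (complex_of_real t)) \<le> norm (P (complex_of_real t))"
          unfolding normQ by (intro mult_right_mono) auto
        also note elim(1)
        finally show ?case using D by (simp add: field_simps)
      qed
      then show ?thesis by blast
    qed
  qed
  then obtain R where "R holomorphic_on A" "\<forall>w\<in>A. Q w = (\<Prod>p\<in>#Z. w - complex_of_real p) * R w" by blast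
  then show ?case by (intro exI[of _ R]) (auto simp: PQ mult_ac)
qed

section \<open>Maximum principle on an annulus and auxiliary estimates\<close>

lemma maximum_modulus_annulus:
  fixes G :: "complex \<Rightarrow> complex"
  assumes hol: "G holomorphic_on -{0}" and "r > 0"
    and B: "\<And>w. norm w = r \<or> norm w = R \<Longrightarrow> norm (G w) \<le> B"
    and w: "r \<le> norm w" "norm w \<le> R"
  shows "norm (G w) \<le> B"
proof -
  define S where "S = cball (0::complex) R \<inter> - ball 0 r"
  have "closed S" unfolding S_def by (intro closed_Int) auto
  have S0: "S \<subseteq> - {0}" using \<open>r > 0\<close> by (auto simp: S_def)
  have int: "ball 0 R \<inter> - cball 0 r \<subseteq> interior S"
    by (rule interior_maximal) (auto simp: S_def)
  show ?thesis
  proof (rule maximum_modulus_frontier[of G S])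
    show "G holomorphic_on interior S"
      using S0 interior_subset by (blast intro: holomorphic_on_subset[OF hol])
    show "continuous_on (closure S) G"
      using \<open>closed S\<close> S0 by (auto intro!: holomorphic_on_imp_continuous_on holomorphic_on_subset[OF hol])
    show "bounded S" by (auto simp: S_def)
    show "w \<in> S" using w by (auto simp: S_def)
    fix z assume "z \<in> frontier S"
    then have "z \<in> S" "z \<notin> interior S" using \<open>closed S\<close> by (auto simp: frontier_def)
    then have "norm z = r \<or> norm z = R" using int by (force simp: S_def)
    then show "norm (G z) \<le> B" by (rule B)
  qed
qed

lemma prod_mset_image_sum:
  "finite K \<Longrightarrow> (\<Prod>p\<in>#(\<Sum>k\<in>K. Z k). f p) = (\<Prod>k\<in>K. \<Prod>p\<in>#Z k. (f p :: 'a :: comm_monoid_mult))"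
  by (induction rule: finite_induct) auto

lemma norm_prod_mset_le:
  fixes f g :: "'a \<Rightarrow> complex"
  assumes "\<And>y. y \<in># Z \<Longrightarrow> norm (f y) \<le> b * norm (g y)" "b \<ge> 0"
  shows "norm (\<Prod>y\<in>#Z. f y) \<le> b ^ size Z * norm (\<Prod>y\<in>#Z. g y)"
  using assms(1)
proof (induction Z)
  case (add y Z)
  have "norm (f y) * norm (\<Prod>y\<in>#Z. f y) \<le> (b * norm (g y)) * (b ^ size Z * norm (\<Prod>y\<in>#Z. g y))"
    using add assms(2) by (intro mult_mono) auto
  then show ?case by (simp add: norm_mult mult_ac)
qed simp

text \<open>Pairs j with -j - 1, matching the half-open range. It serves to add up exponents over
  the 2 n blocks that cover [-n L, n L].\<close>

lemma sum_int_symmetric: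
  fixes f :: "int \<Rightarrow> real"
  shows "(\<Sum>k\<in>{-int n..<int n}. f k) = (\<Sum>j<n. f (int j) + f (- int j - 1))"
proof (induction n)
  case (Suc n)
  have "{-int (Suc n)..<int (Suc n)} = insert (int n) (insert (- int n - 1) {-int n..<int n})"
    by auto
  then show ?case using Suc by simp
qed simp

lemma quadratic_exp_bound_imp_le_0:
  fixes x C \<alpha> \<beta> :: real
  assumes "\<alpha> > 0" "\<forall>\<^sub>F n in sequentially. x \<le> C * exp (- \<alpha> * real n ^ 2 + \<beta> * real n)"
  shows "x \<le> 0"
proof -
  have "\<forall>\<^sub>F n in sequentially. x \<le> \<bar>C\<bar> * exp (- real n)"
    \<comment> \<open>From this index on \<open>\<alpha> * n \<ge> \<beta> + 1\<close>, so the
      exponent is at most \<open>- n\<close>.\<close>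
    using assms(2) eventually_ge_at_top[of "nat \<lceil>(\<beta> + 1) / \<alpha>\<rceil>"]
  proof eventually_elim
    case (elim n)
    have "(\<beta> + 1) / \<alpha> \<le> real n" using elim(2) by linarith
    then have "\<beta> + 1 \<le> \<alpha> * real n" using assms(1) by (simp add: field_simps)
    then have "(\<beta> + 1) * real n \<le> (\<alpha> * real n) * real n" by (intro mult_right_mono) auto
    then have "- \<alpha> * real n ^ 2 + \<beta> * real n \<le> - real n" by (simp add: power2_eq_square algebra_simps)
    then have "C * exp (- \<alpha> * real n ^ 2 + \<beta> * real n) \<le> \<bar>C\<bar> * exp (- real n)"
      by (intro mult_mono) auto
    then show ?case using elim(1) by linarith
  qed
  moreover have "(\<lambda>n. \<bar>C\<bar> * exp (- real n)) \<longlonglongrightarrow> 0" by real_asymp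
  ultimately show ?thesis by (intro tendsto_lowerbound) auto
qed

text \<open>The growth bound corresponds to one zero per unit length, so more than \<open>L\<close>
  zeros per block of length \<open>L\<close> are too many. The margins 1/2 in each block keep the
  zeros away from the boundary circles on which the quotient is estimated.\<close>

lemma laurent_vanish:
  fixes P :: "complex \<Rightarrow> complex" and a L C :: real and M :: nat
  assumes hol: "P holomorphic_on -{0}" and "a > 0" "L > 0" "real M > L"
    and bound: "\<And>x w. norm w = exp (2 * a * x) \<Longrightarrow> norm (P w) \<le> C * exp (a * x\<^sup>2)"
    and zeros: "\<And>k::int. \<exists>Z. size Z = M \<and> set_mset Z \<subseteq> {k * L + 1/2..(k + 1) * L - 1/2} \<and>
       (\<forall>y\<in>#Z. \<exists>B. \<forall>\<^sub>F t in at (exp (2 * a * y)).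
          norm (P (complex_of_real t)) \<le> B * \<bar>t - exp (2 * a * y)\<bar> ^ count Z y)"
    and "w0 \<noteq> 0"
  shows "P w0 = 0"
proof -
  obtain Z :: "int \<Rightarrow> real multiset" where Z_size: "\<And>k. size (Z k) = M"
    and Z_sub: "\<And>k. set_mset (Z k) \<subseteq> {real_of_int k * L + 1/2..(real_of_int k + 1) * L - 1/2}"
    and Z_ord: "\<And>k y. y \<in># Z k \<Longrightarrow> \<exists>B. \<forall>\<^sub>F t in at (exp (2 * a * y)).
          norm (P (complex_of_real t)) \<le> B * \<bar>t - exp (2 * a * y)\<bar> ^ count (Z k) y"
  proof -
    have "\<exists>Z::int \<Rightarrow> real multiset. \<forall>k. size (Z k) = M \<and> set_mset (Z k) \<subseteq> {k * L + 1/2..(k + 1) * L - 1/2} \<and>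
       (\<forall>y\<in>#Z k. \<exists>B. \<forall>\<^sub>F t in at (exp (2 * a * y)).
          norm (P (complex_of_real t)) \<le> B * \<bar>t - exp (2 * a * y)\<bar> ^ count (Z k) y)"
      by (intro choice allI zeros)
    then show ?thesis using that by blast
  qed
  have Z_bd: "k * L + 1/2 \<le> y" "y \<le> (k + 1) * L - 1/2" if "y \<in># Z k" for y k
    using Z_sub[of k] that by auto
  \<comment> \<open>Distinct blocks are disjoint, so multiplicities do not add up when the blocks
    are merged into \<open>ZZ\<close>.\<close>
  have Z_disj: "k = k'" if "y \<in># Z k" "y \<in># Z k'" for y and k k' :: int
  proof -
    have "\<not> (k < k')" if "y \<in># Z k" "y \<in># Z k'" for k k' :: int
    proof
      assume "k < k'"
      then have "(real_of_int k + 1) * L \<le> real_of_int k' * L" using \<open>L > 0\<close> by (intro mult_right_mono) linarith+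
      then show False using Z_bd[OF that(1)] Z_bd[OF that(2)] by linarith
    qed
    then show ?thesis using that by (meson linorder_neqE)
  qed
  define E where "E y = exp (2 * a * y)" for y
  have injE: "inj E" using \<open>a > 0\<close> by (auto simp: inj_def E_def)
  have cntE: "count (image_mset E X) (E y) = count X y" for X y
    by (induction X) (use injE in \<open>auto simp: inj_eq\<close>)
  \<comment> \<open>The margin 1/2 in y becomes a factor \<open>exp a\<close> in \<open>E y\<close>.
    Hence on either boundary circle \<open>norm (w - E y)\<close> is at least \<open>q\<close> times
    the larger of \<open>norm w\<close> and \<open>E y\<close>.\<close>
  define q where "q = 1 - exp (- a)"
  have q: "q > 0" using \<open>a > 0\<close> by (simp add: q_def)
  \<comment> \<open>Chosen so that \<open>norm (w0 - E y) \<le> K * max 1 (E y)\<close>.\<close>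
  define K where "K = 1 + norm w0"
  have K: "K \<ge> 1" by (simp add: K_def)
  \<comment> \<open>\<alpha> is the coefficient of -n^2 on both circles. \<beta> collects what is
    linear in n: a constant K / q for each of 2 n M zeros, the division by
    \<open>w0 ^ (n * M)\<close>, and the term \<open>a * L * M\<close>.\<close>
  define \<alpha> where "\<alpha> = a * L * (real M - L)"
  define \<beta> where "\<beta> = ln ((K / q) ^ (2 * M) / norm w0 ^ M) + a * L * M"
  \<comment> \<open>The two conditions on n place \<open>w0\<close> in the annulus.\<close>
  have "norm (P w0) \<le> C * exp (- \<alpha> * real n ^ 2 + \<beta> * real n)"
    if n: "norm w0 \<le> exp (2 * a * (n * L))" "exp (- (2 * a * (n * L))) \<le> norm w0" for n :: nat
  proof -
    define s where "s = n * L"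
    define J where "J = {-int n..<int n}"
    have finJ: "finite J" by (simp add: J_def)
    define ZZ where "ZZ = (\<Sum>k\<in>J. image_mset E (Z k))"
    have cnt: "count ZZ (E y) = count (Z k) y" if "k \<in> J" "y \<in># Z k" for k y
    proof -
      have "count ZZ (E y) = (\<Sum>k\<in>J. count (Z k) y)"
        by (simp add: ZZ_def count_sum cntE)
      also have "\<dots> = (\<Sum>j\<in>J. if j = k then count (Z k) y else 0)"
        using Z_disj[OF that(2)] by (intro sum.cong) (auto simp flip: not_in_iff)
      also have "\<dots> = count (Z k) y" using finJ that by simp
      finally show ?thesis .
    qed
    have ZZ_mem: "\<exists>k\<in>J. \<exists>y. y \<in># Z k \<and> p = E y" if "p \<in># ZZ" for p
      using that finJ by (auto simp: ZZ_def set_mset_sum)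
    have "\<exists>R. R holomorphic_on -{0} \<and> (\<forall>w\<in>-{0}. P w = (\<Prod>p\<in>#ZZ. w - complex_of_real p) * R w)"
    proof (rule holomorphic_factor_real_zeros[OF hol])
      fix p assume "p \<in># ZZ"
      then obtain k y where ky: "k \<in> J" "y \<in># Z k" "p = E y" using ZZ_mem by blast
      show "complex_of_real p \<in> - {0}" by (simp add: ky(3) E_def)
      show "\<exists>B. \<forall>\<^sub>F t in at p. norm (P (complex_of_real t)) \<le> B * \<bar>t - p\<bar> ^ count ZZ p"
        using Z_ord[OF ky(2)] cnt[OF ky(1,2)] by (simp add: ky(3) flip: E_def)
    qed auto
    then obtain R where R: "R holomorphic_on -{0}"
      and PR: "\<And>w. w \<noteq> 0 \<Longrightarrow> P w = (\<Prod>p\<in>#ZZ. w - complex_of_real p) * R w" by blast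
    define D where "D w = (\<Prod>p\<in>#ZZ. w - complex_of_real p)" for w
    have D_eq: "D w = (\<Prod>k\<in>J. \<Prod>y\<in>#Z k. w - complex_of_real (E y))" for w
      using finJ by (simp add: D_def ZZ_def prod_mset_image_sum image_mset.compositionality o_def)
    \<comment> \<open>\<open>e k\<close> bounds, up to \<open>K / q\<close>, the logarithm of the
      ratio of the factors at \<open>w0\<close> and at \<open>w\<close> for a zero in block k. There
      are 2 n blocks with \<open>M\<close> zeros each.\<close>
    have D_ratio: "norm (D w0) \<le> (K / q) ^ (2 * n * M) * exp (M * (\<Sum>k\<in>J. e k)) * norm (D w)"
      if e: "\<And>k y. k \<in> J \<Longrightarrow> y \<in># Z k \<Longrightarrow>
               norm (w0 - complex_of_real (E y)) \<le> (K / q * exp (e k)) * norm (w - complex_of_real (E y))"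
      for w and e :: "int \<Rightarrow> real"
    proof -
      have "norm (D w0) \<le> (\<Prod>k\<in>J. (K / q * exp (e k)) ^ M * norm (\<Prod>y\<in>#Z k. w - complex_of_real (E y)))"
        unfolding D_eq prod_norm[symmetric]
      proof (intro prod_mono conjI)
        fix k assume "k \<in> J"
        show "norm (\<Prod>y\<in>#Z k. w0 - complex_of_real (E y)) \<le>
              (K / q * exp (e k)) ^ M * norm (\<Prod>y\<in>#Z k. w - complex_of_real (E y))"
          using norm_prod_mset_le[of "Z k" "\<lambda>y. w0 - complex_of_real (E y)" "K / q * exp (e k)"
              "\<lambda>y. w - complex_of_real (E y)"] e[OF \<open>k \<in> J\<close>] K q by (simp add: Z_size)
      qed auto
      also have "\<dots> = (\<Prod>k\<in>J. (K / q * exp (e k)) ^ M) * norm (D w)"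
        by (simp add: D_eq prod.distrib flip: prod_norm)
      also have "(\<Prod>k\<in>J. (K / q * exp (e k)) ^ M) = (\<Prod>k\<in>J. K / q * exp (e k)) ^ M"
        by (simp add: prod_power_distrib)
      also have "(\<Prod>k\<in>J. K / q * exp (e k)) = (K / q) ^ (2 * n) * exp (\<Sum>k\<in>J. e k)"
      proof -
        have "card J = 2 * n" by (simp add: J_def)
        then have "(\<Prod>k\<in>J. K / q) = (K / q) ^ (2 * n)" by (simp only: prod_constant)
        then show ?thesis by (simp only: prod.distrib exp_sum[OF finJ])
      qed
      also have "\<dots> ^ M = (K / q) ^ (2 * n * M) * exp (M * (\<Sum>k\<in>J. e k))"
        by (simp add: power_mult power_mult_distrib exp_of_nat_mult)
      finally show ?thesis by simp
    qed
    \<comment> \<open>The common bound for \<open>G\<close> on both circles; the equation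
      \<open>se\<close> below has to be verified once for each circle.\<close>
    define T where "T = (K / q) ^ (2 * n * M) * C * exp (- \<alpha> * real n ^ 2 + a * L * M * n)"
    \<comment> \<open>The power of \<open>w\<close> balances the two boundary circles: \<open>D\<close> has degree \<open>2 n M\<close>, half of its zeros
        lie on either side of the unit circle.\<close>
    define G where "G w = D w0 * w ^ (n * M) * R w" for w
    have y_bd: "- s + 1/2 \<le> y" "y \<le> s - 1/2" if "k \<in> J" "y \<in># Z k" for k y
    proof -
      have "- real n \<le> real_of_int k" "real_of_int k + 1 \<le> real n"
        using that(1) by (auto simp: J_def)
      then have "- real n * L \<le> k * L" "(k + 1) * L \<le> real n * L"
        using \<open>L > 0\<close> by (simp_all only: mult_right_mono less_imp_le)
      then show "- s + 1/2 \<le> y" "y \<le> s - 1/2" using Z_bd[OF that(2)] by (auto simp: s_def)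
    qed
    have w0_bd: "norm (w0 - complex_of_real (E y)) \<le> K * max 1 (E y)" for y
    proof -
      have "norm (w0 - complex_of_real (E y)) \<le> norm w0 + E y"
        by (rule order_trans[OF norm_triangle_ineq4]) (simp add: E_def)
      also have "\<dots> \<le> K * max 1 (E y)"
      proof -
        have "norm w0 * 1 \<le> norm w0 * max 1 (E y)" by (intro mult_left_mono) auto
        then show ?thesis by (simp add: K_def algebra_simps)
      qed
      finally show ?thesis .
    qed
    \<comment> \<open>\<open>max_le\<close> is absolute, for the outer circle, where the
      denominators are of size \<open>exp (2 * a * s)\<close>. \<open>max_le'\<close> is relative to
      \<open>E y\<close>, for the inner circle, where they are of size \<open>E y\<close>.\<close>
    have max_le: "max 1 (E y) \<le> (if k \<ge> 0 then exp (2 * a * (k + 1) * L) else 1)"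
      and max_le': "max 1 (E y) \<le> (if k \<ge> 0 then 1 else exp (- (2 * a * k * L))) * E y"
      if "y \<in># Z k" for k y
    proof -
      show "max 1 (E y) \<le> (if k \<ge> 0 then exp (2 * a * (k + 1) * L) else 1)"
      proof (cases "k \<ge> 0")
        case True
        have "E y \<le> exp (2 * a * ((k + 1) * L))"
          unfolding E_def exp_le_cancel_iff using Z_bd[OF that] \<open>a > 0\<close> by (intro mult_left_mono) auto
        then show ?thesis using True \<open>a > 0\<close> \<open>L > 0\<close> by (simp add: mult_ac)
      next
        case False
        then have "(k + 1) * L \<le> 0" using \<open>L > 0\<close> by (intro mult_nonpos_nonneg) auto
        then have "y \<le> 0" using Z_bd[OF that] by auto
        then show ?thesis using False \<open>a > 0\<close> by (simp add: E_def mult_le_0_iff)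
      qed
      show "max 1 (E y) \<le> (if k \<ge> 0 then 1 else exp (- (2 * a * k * L))) * E y"
      proof (cases "k \<ge> 0")
        case True
        then have "k * L \<ge> 0" using \<open>L > 0\<close> by auto
        then have "y \<ge> 0" using Z_bd[OF that] by auto
        then show ?thesis using True \<open>a > 0\<close> by (simp add: E_def)
      next
        case False
        have eq: "exp (- (2 * a * k * L)) * E y = exp (2 * a * (y - k * L))"
          by (simp add: E_def algebra_simps flip: exp_add)
        have "k * L \<le> 0" using False \<open>L > 0\<close> by (intro mult_nonpos_nonneg) auto
        then have "2 * a * 0 \<le> 2 * a * (y - k * L)" "2 * a * y \<le> 2 * a * (y - k * L)"
          using Z_bd[OF that] \<open>a > 0\<close> by (auto intro!: mult_left_mono)
        then have "max 1 (E y) \<le> exp (2 * a * (y - k * L))" by (simp add: E_def)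
        then show ?thesis using False eq by simp
      qed
    qed
    have Rw: "norm (G w) \<le> T" if nw: "norm w = exp (- (2 * a * s)) \<or> norm w = exp (2 * a * s)" for w
    proof -
      have w0': "w \<noteq> 0" using nw by auto
      \<comment> \<open>The left side of \<open>se\<close> adds up three exponents: from
        \<open>w ^ (n * M)\<close>, from the growth bound of \<open>P\<close>, and from the ratio of
        the products \<open>D\<close>.\<close>
      have *: "norm (G w) \<le> T"
        if x: "norm w = exp (2 * a * x)" "x\<^sup>2 = s\<^sup>2"
          and e: "\<And>k y. k \<in> J \<Longrightarrow> y \<in># Z k \<Longrightarrow>
               norm (w0 - complex_of_real (E y)) \<le> (K / q * exp (e k)) * norm (w - complex_of_real (E y))"
          and se: "2 * a * x * (n * M) + a * s\<^sup>2 + M * (\<Sum>k\<in>J. e k) = - \<alpha> * real n ^ 2 + a * L * M * n"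
        for x and e :: "int \<Rightarrow> real"
      proof -
        have "norm (G w) = norm (D w0) * norm w ^ (n * M) * norm (R w)"
          by (simp add: G_def norm_mult norm_power)
        also have "\<dots> \<le> ((K / q) ^ (2 * n * M) * exp (M * (\<Sum>k\<in>J. e k)) * norm (D w)) * norm w ^ (n * M) * norm (R w)"
          by (intro mult_right_mono D_ratio e) auto
        also have "\<dots> = (K / q) ^ (2 * n * M) * exp (M * (\<Sum>k\<in>J. e k)) * norm w ^ (n * M) * norm (P w)"
          using PR[OF w0'] by (simp add: D_def norm_mult)
        also have "\<dots> \<le> (K / q) ^ (2 * n * M) * exp (M * (\<Sum>k\<in>J. e k)) * norm w ^ (n * M) * (C * exp (a * x\<^sup>2))"
          using K q by (intro mult_left_mono bound[OF x(1)]) auto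
        also have "norm w ^ (n * M) = exp (2 * a * x * (n * M))"
          unfolding x(1) by (simp add: exp_of_nat_mult[symmetric] mult_ac)
        also have "(K / q) ^ (2 * n * M) * exp (M * (\<Sum>k\<in>J. e k)) * exp (2 * a * x * (n * M)) * (C * exp (a * x\<^sup>2))
            = (K / q) ^ (2 * n * M) * C * exp (2 * a * x * (n * M) + a * s\<^sup>2 + M * (\<Sum>k\<in>J. e k))"
          by (simp add: exp_add x(2))
        also have "\<dots> = T" by (simp only: se T_def)
        finally show ?thesis .
      qed
      \<comment> \<open>The block exponents: they come from k = j on the outer circle and from k =
        -j - 1 on the inner one.\<close>
      have gauss: "(\<Sum>j<n. 2 * a * (real j + 1) * L) = a * L * n * (n + 1)"
        by (induction n) (auto simp: algebra_simps)
      from nw show ?thesis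
      proof
        assume w: "norm w = exp (2 * a * s)"
        show ?thesis
        \<comment> \<open>Outer circle: the numerator is at most \<open>K\<close> times the bound at
          the right end of the block, and the denominator is at least
          \<open>q * exp (2 * a * s)\<close>.\<close>
        proof (rule *[of s "\<lambda>k. (if k \<ge> 0 then 2 * a * (real_of_int k + 1) * L else 0) - 2 * a * s"])
          fix k y assume ky: "k \<in> J" "y \<in># Z k"
          have "E y \<le> exp (2 * a * s) * exp (- a)"
            unfolding E_def exp_add[symmetric] exp_le_cancel_iff
            using mult_left_mono[OF y_bd(2)[OF ky], of "2 * a"] \<open>a > 0\<close> by (simp add: algebra_simps)
          then have "q * exp (2 * a * s) \<le> norm w - E y" by (simp add: w q_def algebra_simps)
          also have "\<dots> \<le> norm (w - complex_of_real (E y))"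
            using norm_triangle_ineq2[of w "complex_of_real (E y)"] by (simp add: E_def)
          finally have *: "q * exp (2 * a * s) \<le> norm (w - complex_of_real (E y))" .
          let ?b = "if k \<ge> 0 then exp (2 * a * (k + 1) * L) else 1"
          have "norm (w0 - complex_of_real (E y)) \<le> K * ?b"
            using w0_bd[of y] mult_left_mono[OF max_le[OF ky(2)], of K] K by linarith
          also have "\<dots> = K / q * ?b * exp (- (2 * a * s)) * (q * exp (2 * a * s))"
            using q by (simp add: exp_minus field_simps)
          also have "\<dots> \<le> K / q * ?b * exp (- (2 * a * s)) * norm (w - complex_of_real (E y))"
            using * K q by (intro mult_left_mono) auto
          finally show "norm (w0 - complex_of_real (E y)) \<le>
            K / q * exp ((if k \<ge> 0 then 2 * a * (real_of_int k + 1) * L else 0) - 2 * a * s) * norm (w - complex_of_real (E y))"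
            by (simp add: exp_diff exp_minus divide_inverse split: if_splits)
        next
          have sume: "(\<Sum>k\<in>J. (if k \<ge> 0 then 2 * a * (real_of_int k + 1) * L else 0) - 2 * a * s)
              = a * L * n * (n + 1) - 4 * a * s * n"
            unfolding J_def sum_int_symmetric using gauss by (simp add: sum_subtractf algebra_simps)
          \<comment> \<open>With \<open>s = n * L\<close> the coefficient of n^2 is 2 a L M + a L^2
            + a L M - 4 a L M = -a L (M - L).\<close>
          show "2 * a * s * (n * M) + a * s\<^sup>2 +
             M * (\<Sum>k\<in>J. (if k \<ge> 0 then 2 * a * (real_of_int k + 1) * L else 0) - 2 * a * s)
             = - \<alpha> * real n ^ 2 + a * L * M * n"
            unfolding sume by (simp add: \<alpha>_def s_def power2_eq_square algebra_simps)
        qed (use w in auto)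
      next
        assume w: "norm w = exp (- (2 * a * s))"
        show ?thesis
        \<comment> \<open>Inner circle: the denominator is at least \<open>q * E y\<close>, so only
          blocks with negative k contribute an exponent.\<close>
        proof (rule *[of "-s" "\<lambda>k::int. (if k \<ge> 0 then 0 else - (2 * a * real_of_int k * L))"])
          fix k y assume ky: "k \<in> J" "y \<in># Z k"
          have "exp (- (2 * a * s)) \<le> exp (- a) * E y"
            unfolding E_def exp_add[symmetric] exp_le_cancel_iff
            using mult_left_mono[OF y_bd(1)[OF ky], of "2 * a"] \<open>a > 0\<close> by (simp add: algebra_simps)
          then have "q * E y \<le> E y - norm w" by (simp add: w q_def algebra_simps)
          also have "\<dots> \<le> norm (w - complex_of_real (E y))"
            using norm_triangle_ineq2[of "complex_of_real (E y)" w] by (simp add: E_def norm_minus_commute)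
          finally have *: "q * E y \<le> norm (w - complex_of_real (E y))" .
          let ?b = "if k \<ge> 0 then 1 else exp (- (2 * a * k * L))"
          have "norm (w0 - complex_of_real (E y)) \<le> K * (?b * E y)"
            using w0_bd[of y] mult_left_mono[OF max_le'[OF ky(2)], of K] K by linarith
          also have "\<dots> = K / q * ?b * (q * E y)"
            using q by simp
          also have "\<dots> \<le> K / q * ?b * norm (w - complex_of_real (E y))"
            using * K q by (intro mult_left_mono) auto
          finally show "norm (w0 - complex_of_real (E y)) \<le>
            K / q * exp (if k \<ge> 0 then 0 else - (2 * a * k * L)) * norm (w - complex_of_real (E y))"
            by (simp split: if_splits)
        next
          have sume: "(\<Sum>k\<in>J. (if k \<ge> 0 then 0 else - (2 * a * real_of_int k * L))) = a * L * n * (n + 1)"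
            unfolding J_def sum_int_symmetric using gauss by (simp add: algebra_simps)
          \<comment> \<open>Now the coefficient of n^2 is -2 a L M + a L^2 + a L M, the same
            value.\<close>
          show "2 * a * - s * (n * M) + a * s\<^sup>2 +
             M * (\<Sum>k\<in>J. (if k \<ge> 0 then 0 else - (2 * a * real_of_int k * L)))
             = - \<alpha> * real n ^ 2 + a * L * M * n"
            unfolding sume by (simp add: \<alpha>_def s_def power2_eq_square algebra_simps)
        qed (use w in auto)
      qed
    qed
    have "norm (G w0) \<le> T"
    proof (rule maximum_modulus_annulus[of G "exp (- (2 * a * s))" "exp (2 * a * s)"])
      show "G holomorphic_on - {0}" unfolding G_def using R by (intro holomorphic_intros)
      show "0 < exp (- (2 * a * s))" by simp
      show "exp (- (2 * a * s)) \<le> norm w0" "norm w0 \<le> exp (2 * a * s)" using n by (auto simp: s_def)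
    qed (use Rw in blast)
    \<comment> \<open>Since \<open>D w0 * R w0 = P w0\<close>, the value \<open>G w0\<close> is
      \<open>P w0 * w0 ^ (n * M)\<close>.\<close>
    then have "norm (P w0) * norm w0 ^ (n * M) \<le> T"
      using PR[OF \<open>w0 \<noteq> 0\<close>] by (simp add: G_def D_def norm_mult norm_power mult_ac)
    then have "norm (P w0) \<le> T / norm w0 ^ (n * M)" using \<open>w0 \<noteq> 0\<close> by (simp add: field_simps)
    also have "\<dots> = C * (((K / q) ^ (2 * M) / norm w0 ^ M) ^ n * exp (- \<alpha> * real n ^ 2 + a * L * M * n))"
      by (simp add: T_def power_divide power_mult_distrib mult_ac flip: power_mult)
    also have "((K / q) ^ (2 * M) / norm w0 ^ M) ^ n = exp (ln ((K / q) ^ (2 * M) / norm w0 ^ M) * n)"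
      using K q \<open>w0 \<noteq> 0\<close> by (subst mult.commute, subst exp_of_nat_mult) (simp add: exp_ln)
    also have "\<dots> * exp (- \<alpha> * real n ^ 2 + a * L * M * n) = exp (- \<alpha> * real n ^ 2 + \<beta> * real n)"
      by (simp add: \<beta>_def algebra_simps flip: exp_add)
    finally show ?thesis .
  qed
  note est = this
  have up: "\<forall>\<^sub>F n in sequentially. norm w0 \<le> exp (2 * a * (real n * L))"
    and lo: "\<forall>\<^sub>F n in sequentially. exp (- (2 * a * (real n * L))) \<le> norm w0"
  proof -
    have pos: "2 * a * L > 0" using \<open>a > 0\<close> \<open>L > 0\<close> by simp
    have lim: "filterlim (\<lambda>n. (2 * a * L) * real n) at_top sequentially"
      by (rule filterlim_tendsto_pos_mult_at_top[OF tendsto_const pos filterlim_real_sequentially])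
    have ev: "\<forall>\<^sub>F n in sequentially. \<bar>ln (norm w0)\<bar> \<le> (2 * a * L) * real n"
      using lim by (simp add: filterlim_at_top)
    from ev show "\<forall>\<^sub>F n in sequentially. norm w0 \<le> exp (2 * a * (real n * L))"
    proof eventually_elim
      case (elim n)
      then have "ln (norm w0) \<le> 2 * a * (real n * L)" by (simp add: mult_ac)
      then show ?case using \<open>w0 \<noteq> 0\<close> by (metis exp_le_cancel_iff exp_ln zero_less_norm_iff)
    qed
    from ev show "\<forall>\<^sub>F n in sequentially. exp (- (2 * a * (real n * L))) \<le> norm w0"
    proof eventually_elim
      case (elim n)
      then have "- (2 * a * (real n * L)) \<le> ln (norm w0)" by (simp add: mult_ac)
      then show ?case using \<open>w0 \<noteq> 0\<close> by (metis exp_le_cancel_iff exp_ln zero_less_norm_iff)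
    qed
  qed
  from up lo have ev: "\<forall>\<^sub>F n in sequentially. norm (P w0) \<le> C * exp (- \<alpha> * real n ^ 2 + \<beta> * real n)"
    by eventually_elim (rule est)
  have "\<alpha> > 0" using assms(2-4) by (simp add: \<alpha>_def)
  from quadratic_exp_bound_imp_le_0[OF this ev] show ?thesis by simp
qed

section \<open>Series of Gaussian shifts\<close>

lemma summable_on_bounded_mult:
  fixes g c :: "'a \<Rightarrow> real"
  assumes g: "g summable_on A" and nonneg: "\<And>k. 0 \<le> g k" and c: "\<And>k. \<bar>c k\<bar> \<le> B"
  shows "(\<lambda>k. c k * g k) summable_on A"
proof (rule abs_summable_summable, rule Infinite_Sum.abs_summable_on_comparison_test')
  show "(\<lambda>k. B * g k) summable_on A" by (rule summable_on_cmult_right[OF g])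
  show "norm (c k * g k) \<le> B * g k" for k
    using mult_right_mono[OF c nonneg] by (simp add: abs_mult nonneg)
qed

lemma summable_on_exp_minus_abs_int: "(\<lambda>k::int. exp (- \<bar>real_of_int k\<bar>)) summable_on UNIV"
proof -
  have geo: "summable (\<lambda>n. exp (- 1) ^ n :: real)" by (rule summable_geometric) simp
  then have "summable (\<lambda>n. exp (- real n))"
    by (simp flip: exp_of_nat_mult)
  then have nat: "(\<lambda>n. exp (- real n)) summable_on UNIV"
    by (rule summable_nonneg_imp_summable_on) simp
  have "(\<lambda>k::int. exp (- \<bar>real_of_int k\<bar>)) summable_on range int"
    using nat by (subst summable_on_reindex) (auto simp: o_def)
  moreover have "(\<lambda>k::int. exp (- \<bar>real_of_int k\<bar>)) summable_on range (\<lambda>n. - int n - 1)"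
  proof (subst summable_on_reindex)
    show "((\<lambda>k::int. exp (- \<bar>real_of_int k\<bar>)) \<circ> (\<lambda>n. - int n - 1)) summable_on UNIV"
      using summable_on_cmult_right[OF nat, of "exp (- 1)"]
      by (simp add: o_def flip: exp_add)
  qed (auto simp: inj_def)
  ultimately have "(\<lambda>k::int. exp (- \<bar>real_of_int k\<bar>)) summable_on (range int \<union> range (\<lambda>n. - int n - 1))"
    by (rule summable_on_Un_disjoint) auto
  moreover have "k \<in> range int \<union> range (\<lambda>n. - int n - 1)" for k :: int
    by (cases k rule: int_cases) auto
  then have "range int \<union> range (\<lambda>n. - int n - 1) = UNIV" by blast
  ultimately show ?thesis by simp
qed

lemma summable_on_exp_quadratic_int:
  fixes a b :: real
  assumes "a > 0"
  shows "(\<lambda>k::int. exp (- a * (real_of_int k)\<^sup>2 + b * real_of_int k)) summable_on UNIV"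
proof (rule summable_on_comparison_test)
  \<comment> \<open>The maximum over t of \<open>- a * t^2 + (\<bar>b\<bar> + 1) * t\<close>; it
    leaves \<open>- \<bar>k\<bar>\<close> to spare in the exponent.\<close>
  let ?D = "(\<bar>b\<bar> + 1)\<^sup>2 / (4 * a)"
  show "(\<lambda>k::int. exp ?D * exp (- \<bar>real_of_int k\<bar>)) summable_on UNIV"
    by (rule summable_on_cmult_right[OF summable_on_exp_minus_abs_int])
  fix k :: int
  define t where "t = \<bar>real_of_int k\<bar>"
  have "0 \<le> (2 * a * t - (\<bar>b\<bar> + 1))\<^sup>2" by simp
  then have "4 * a * (- a * t\<^sup>2 + (\<bar>b\<bar> + 1) * t) \<le> (\<bar>b\<bar> + 1)\<^sup>2"
    by (simp add: power2_eq_square algebra_simps)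
  then have "- a * t\<^sup>2 + (\<bar>b\<bar> + 1) * t \<le> ?D" using assms by (simp add: field_simps)
  moreover have "b * real_of_int k \<le> \<bar>b\<bar> * t" unfolding t_def
    by (metis abs_ge_self abs_mult)
  ultimately have "- a * (real_of_int k)\<^sup>2 + b * real_of_int k \<le> ?D + - t"
    by (simp add: t_def algebra_simps)
  then show "exp (- a * (real_of_int k)\<^sup>2 + b * real_of_int k) \<le> exp ?D * exp (- \<bar>real_of_int k\<bar>)"
    unfolding t_def exp_add[symmetric] exp_le_cancel_iff .
qed auto

lemma exp_shifted_square:
  "exp (- a * (x - k)\<^sup>2) = exp (- a * x\<^sup>2) * exp (- a * k\<^sup>2 + (2 * a * x) * k)" for a x k :: real
  by (simp add: power2_eq_square algebra_simps flip: exp_add)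

lemma summable_on_gauss_shifts:
  fixes a x :: real
  assumes "a > 0"
  shows "(\<lambda>k::int. exp (- a * (x - real_of_int k)\<^sup>2)) summable_on UNIV"
  unfolding exp_shifted_square
  by (rule summable_on_cmult_right[OF summable_on_exp_quadratic_int[OF assms]])

text \<open>The sum is 1-periodic in x, so x may be replaced by its fractional part \<theta>; on
  [0, 1] one series dominates for all \<theta>.\<close>

lemma infsum_gauss_shifts_bounded:
  fixes a :: real
  assumes "a > 0"
  shows "\<exists>\<Theta>. \<forall>x. (\<Sum>\<^sub>\<infinity>k::int. exp (- a * (x - real_of_int k)\<^sup>2)) \<le> \<Theta>"
proof (intro exI allI)
  fix x :: real
  define \<theta> where "\<theta> = x - \<lfloor>x\<rfloor>"
  have \<theta>: "0 \<le> \<theta>" "\<theta> \<le> 1" unfolding \<theta>_def by linarith+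
  have "bij (\<lambda>k. k + \<lfloor>x\<rfloor>)"
    by (rule bij_betw_byWitness[of _ "\<lambda>k. k - \<lfloor>x\<rfloor>"]) auto
  then have "(\<Sum>\<^sub>\<infinity>k::int. exp (- a * (x - real_of_int k)\<^sup>2)) =
      (\<Sum>\<^sub>\<infinity>k::int. exp (- a * (x - real_of_int (k + \<lfloor>x\<rfloor>))\<^sup>2))"
    by (rule infsum_reindex_bij_betw[symmetric])
  also have "\<dots> = (\<Sum>\<^sub>\<infinity>k::int. exp (- a * (\<theta> - real_of_int k)\<^sup>2))"
    by (simp add: \<theta>_def algebra_simps)
  also have "\<dots> \<le> (\<Sum>\<^sub>\<infinity>k::int. exp a * exp (- (a / 2) * (real_of_int k)\<^sup>2 + 0 * real_of_int k))"
  proof (rule infsum_mono)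
    show "(\<lambda>k::int. exp (- a * (\<theta> - real_of_int k)\<^sup>2)) summable_on UNIV"
      by (rule summable_on_gauss_shifts[OF assms])
    show "(\<lambda>k::int. exp a * exp (- (a / 2) * (real_of_int k)\<^sup>2 + 0 * real_of_int k)) summable_on UNIV"
      by (intro summable_on_cmult_right summable_on_exp_quadratic_int) (use assms in auto)
    fix k :: int
    let ?k = "real_of_int k"
    \<comment> \<open>The right side equals \<open>2 * (\<theta> - k)^2 - k^2 + 2\<close>.\<close>
    have "0 \<le> (2 * \<theta> - ?k)\<^sup>2 + 2 * (1 - \<theta>\<^sup>2)"
      using \<theta> by (intro add_nonneg_nonneg) (auto simp: power_le_one)
    then have "- (\<theta> - ?k)\<^sup>2 \<le> 1 - ?k\<^sup>2 / 2" by (simp add: power2_eq_square algebra_simps)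
    then have "a * (- (\<theta> - ?k)\<^sup>2) \<le> a * (1 - ?k\<^sup>2 / 2)" using assms by (intro mult_left_mono) auto
    then have "- a * (\<theta> - ?k)\<^sup>2 \<le> a + (- (a / 2) * ?k\<^sup>2 + 0 * ?k)" by (simp add: algebra_simps)
    then show "exp (- a * (\<theta> - ?k)\<^sup>2) \<le> exp a * exp (- (a / 2) * ?k\<^sup>2 + 0 * ?k)"
      unfolding exp_add[symmetric] exp_le_cancel_iff .
  qed
  finally show "(\<Sum>\<^sub>\<infinity>k::int. exp (- a * (x - real_of_int k)\<^sup>2)) \<le>
     (\<Sum>\<^sub>\<infinity>k::int. exp a * exp (- (a / 2) * (real_of_int k)\<^sup>2 + 0 * real_of_int k))" .
qed

text \<open>Substituting \<open>w = exp (2 a x)\<close> turns \<open>\<Sum> c k exp (- a (x - k)\<^sup>2)\<close> into \<open>exp (- a x\<^sup>2)\<close> times this Laurent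
  series.\<close>

definition gauss_laurent :: "real \<Rightarrow> (int \<Rightarrow> real) \<Rightarrow> complex \<Rightarrow> complex" where
  "gauss_laurent a c w = (\<Sum>\<^sub>\<infinity>k. complex_of_real (c k * exp (- a * (real_of_int k)\<^sup>2)) * w powi k)"

lemma norm_power_int_exp: "norm w = exp y \<Longrightarrow> norm (w powi k :: complex) = exp (y * real_of_int k)"
  by (simp add: norm_power_int exp_power_int mult.commute)

text \<open>Gaussian coefficients beat any exponential in |k|, so the M-test gives uniform
  convergence on the disc of radius |z| / 2 about z, which avoids 0.\<close>

lemma gauss_laurent_holomorphic:
  assumes "a > 0" and c: "\<And>k. \<bar>c k\<bar> \<le> B"
  shows "gauss_laurent a c holomorphic_on -{0}"
proof -
  have "gauss_laurent a c holomorphic_on ball z (norm z / 2)" if z: "z \<noteq> 0" for z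
  proof (rule holomorphic_uniform_limit)
    let ?C = "cball z (norm z / 2)"
    \<comment> \<open>Bounds \<open>\<bar>ln (norm w)\<bar>\<close> on the disc. The majorant uses
      the sum of \<open>exp (b * k)\<close> and \<open>exp (- b * k)\<close> in place of
      \<open>exp (b * \<bar>k\<bar>)\<close>, so each half is a summable quadratic
      exponential.\<close>
    define b where "b = \<bar>ln (norm z / 2)\<bar> + \<bar>ln (3 * norm z / 2)\<bar>"
    define Mj where "Mj k = B * (exp (- a * (real_of_int k)\<^sup>2 + b * real_of_int k) +
        exp (- a * (real_of_int k)\<^sup>2 + (- b) * real_of_int k))" for k
    have C0: "norm z / 2 \<le> norm w" "norm w \<le> 3 * norm z / 2" if "w \<in> ?C" for w
      using that norm_triangle_ineq2[of z w] norm_triangle_ineq2[of w z]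
      by (auto simp: dist_norm norm_minus_commute)
    have C0': "w \<noteq> 0" if "w \<in> ?C" for w using C0[OF that] z by auto
    show "uniform_limit ?C (\<lambda>X w. \<Sum>k\<in>X. complex_of_real (c k * exp (- a * (real_of_int k)\<^sup>2)) * w powi k)
       (gauss_laurent a c) (finite_subsets_at_top UNIV)"
      unfolding gauss_laurent_def
    proof (rule Weierstrass_m_test_general)
      show "Mj summable_on UNIV"
        unfolding Mj_def
        by (intro summable_on_cmult_right summable_on_add summable_on_exp_quadratic_int assms(1))
      fix k :: int and w assume w: "w \<in> ?C"
      have wpos: "norm w > 0" using C0'[OF w] by simp
      have "ln (norm z / 2) \<le> ln (norm w)" "ln (norm w) \<le> ln (3 * norm z / 2)"
        using C0[OF w] z wpos by (auto simp: ln_le_cancel_iff)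
      then have lb: "\<bar>ln (norm w)\<bar> \<le> b" unfolding b_def by linarith
      have "ln (norm w) * k \<le> \<bar>ln (norm w)\<bar> * \<bar>real_of_int k\<bar>" by (metis abs_ge_self abs_mult)
      also have "\<dots> \<le> b * \<bar>real_of_int k\<bar>" using lb by (intro mult_right_mono) auto
      finally have "exp (ln (norm w) * k) \<le> exp (b * k) + exp ((- b) * k)"
      proof -
        assume "ln (norm w) * k \<le> b * \<bar>real_of_int k\<bar>"
        then have "ln (norm w) * k \<le> b * k \<or> ln (norm w) * k \<le> (- b) * k"
          by (cases "k \<ge> 0") auto
        then have "exp (ln (norm w) * k) \<le> exp (b * k) \<or> exp (ln (norm w) * k) \<le> exp ((- b) * k)"
          by (simp only: exp_le_cancel_iff)
        moreover have "exp (b * k) > 0" "exp ((- b) * k) > 0" by simp_all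
        ultimately show ?thesis by linarith
      qed
      then have "norm (w powi k) \<le> exp (b * k) + exp ((- b) * k)"
        using norm_power_int_exp[of w "ln (norm w)" k] wpos by simp
      moreover have "norm (complex_of_real (c k * exp (- a * (real_of_int k)\<^sup>2))) \<le> B * exp (- a * (real_of_int k)\<^sup>2)"
        using c[of k] by (simp add: norm_mult mult_right_mono)
      ultimately have "norm (complex_of_real (c k * exp (- a * (real_of_int k)\<^sup>2)) * w powi k) \<le>
          (B * exp (- a * (real_of_int k)\<^sup>2)) * (exp (b * k) + exp ((- b) * k))"
        unfolding norm_mult by (intro mult_mono) (use c[of k] in auto)
      also have "\<dots> = Mj k" unfolding Mj_def by (simp add: algebra_simps exp_add exp_diff)
        (simp add: exp_minus divide_inverse)
      finally show "norm (complex_of_real (c k * exp (- a * (real_of_int k)\<^sup>2)) * w powi k) \<le> Mj k" .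
    qed
    show "\<forall>\<^sub>F X in finite_subsets_at_top UNIV.
       continuous_on ?C (\<lambda>w. \<Sum>k\<in>X. complex_of_real (c k * exp (- a * (real_of_int k)\<^sup>2)) * w powi k) \<and>
       (\<lambda>w. \<Sum>k\<in>X. complex_of_real (c k * exp (- a * (real_of_int k)\<^sup>2)) * w powi k) holomorphic_on ball z (norm z / 2)"
      by (intro always_eventually allI conjI continuous_intros holomorphic_intros) (use C0' in auto)
  qed auto
  then have "gauss_laurent a c analytic_on -{0}"
    unfolding analytic_on_def by (metis ComplD half_gt_zero insertI1 zero_less_norm_iff)
  then show ?thesis by (rule analytic_imp_holomorphic)
qed

text \<open>Completing the square on this circle turns the modulus of the k-th term into
  \<open>\<bar>c k\<bar> * exp (a * x^2)\<close> times the Gaussian shifted by k.\<close>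

lemma gauss_laurent_bound:
  assumes "a > 0" and c: "\<And>k. \<bar>c k\<bar> \<le> B"
    and \<Theta>: "\<And>x. (\<Sum>\<^sub>\<infinity>k::int. exp (- a * (x - real_of_int k)\<^sup>2)) \<le> \<Theta>"
    and w: "norm w = exp (2 * a * x)"
  shows "norm (gauss_laurent a c w) \<le> (B * \<Theta>) * exp (a * x\<^sup>2)"
proof -
  have B: "B \<ge> 0" using c[of 0] by linarith
  let ?g = "\<lambda>k::int. (B * exp (a * x\<^sup>2)) * exp (- a * (x - real_of_int k)\<^sup>2)"
  have sg: "?g summable_on UNIV"
    by (intro summable_on_cmult_right summable_on_gauss_shifts assms)
  have le: "norm (complex_of_real (c k * exp (- a * (real_of_int k)\<^sup>2)) * w powi k) \<le> ?g k" for k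
  proof -
    have "norm (complex_of_real (c k * exp (- a * (real_of_int k)\<^sup>2)) * w powi k) =
        \<bar>c k\<bar> * (exp (- a * (real_of_int k)\<^sup>2) * exp (2 * a * x * real_of_int k))"
      using norm_power_int_exp[OF w, of k] by (simp add: norm_mult)
    also have "\<dots> \<le> B * (exp (- a * (real_of_int k)\<^sup>2) * exp (2 * a * x * real_of_int k))"
      by (intro mult_right_mono c) auto
    also have "\<dots> = ?g k"
      by (simp add: power2_eq_square algebra_simps flip: exp_add)
    finally show ?thesis .
  qed
  have sm: "(\<lambda>k. complex_of_real (c k * exp (- a * (real_of_int k)\<^sup>2)) * w powi k) summable_on UNIV"
    by (rule abs_summable_summable[OF Infinite_Sum.abs_summable_on_comparison_test'[OF sg le]])
  have "norm (gauss_laurent a c w) \<le> infsum ?g UNIV"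
    unfolding gauss_laurent_def
    by (rule norm_infsum_le[OF has_sum_infsum[OF sm] has_sum_infsum[OF sg] le])
  also have "\<dots> = (B * exp (a * x\<^sup>2)) * (\<Sum>\<^sub>\<infinity>k::int. exp (- a * (x - real_of_int k)\<^sup>2))"
    by (rule infsum_cmult_right')
  also have "\<dots> \<le> (B * exp (a * x\<^sup>2)) * \<Theta>" using B by (intro mult_left_mono \<Theta>) auto
  finally show ?thesis by (simp add: mult_ac)
qed

lemma gauss_laurent_of_real:
  assumes "a > 0" and c: "\<And>k. \<bar>c k\<bar> \<le> B"
  shows "gauss_laurent a c (complex_of_real (exp (2 * a * x))) =
     complex_of_real (exp (a * x\<^sup>2) * (\<Sum>\<^sub>\<infinity>k. c k * exp (- a * (x - real_of_int k)\<^sup>2)))"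
proof -
  have "(\<lambda>k. c k * exp (- a * (x - real_of_int k)\<^sup>2)) summable_on UNIV"
    by (rule summable_on_bounded_mult[OF summable_on_gauss_shifts[OF assms(1)] _ c]) simp
  then have "((\<lambda>k. exp (a * x\<^sup>2) * (c k * exp (- a * (x - real_of_int k)\<^sup>2))) has_sum
     (exp (a * x\<^sup>2) * (\<Sum>\<^sub>\<infinity>k. c k * exp (- a * (x - real_of_int k)\<^sup>2)))) UNIV"
    by (intro has_sum_cmult_right has_sum_infsum)
  then have "((\<lambda>k. complex_of_real (exp (a * x\<^sup>2) * (c k * exp (- a * (x - real_of_int k)\<^sup>2)))) has_sum
     complex_of_real (exp (a * x\<^sup>2) * (\<Sum>\<^sub>\<infinity>k. c k * exp (- a * (x - real_of_int k)\<^sup>2)))) UNIV"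
    by (rule has_sum_of_real)
  moreover have "complex_of_real (exp (a * x\<^sup>2) * (c k * exp (- a * (x - real_of_int k)\<^sup>2))) =
     complex_of_real (c k * exp (- a * (real_of_int k)\<^sup>2)) * complex_of_real (exp (2 * a * x)) powi k" for k
  proof -
    have "complex_of_real (exp (2 * a * x)) powi k = complex_of_real (exp (2 * a * x * real_of_int k))"
      by (simp add: exp_power_int mult_ac flip: of_real_power_int)
    moreover have "exp (a * x\<^sup>2) * (c k * exp (- a * (x - real_of_int k)\<^sup>2)) =
        (c k * exp (- a * (real_of_int k)\<^sup>2)) * exp (2 * a * x * real_of_int k)"
      by (simp add: power2_eq_square algebra_simps flip: exp_add)
    ultimately show ?thesis by (simp only: of_real_mult)
  qed
  ultimately have "((\<lambda>k. complex_of_real (c k * exp (- a * (real_of_int k)\<^sup>2)) *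
      complex_of_real (exp (2 * a * x)) powi k) has_sum
     complex_of_real (exp (a * x\<^sup>2) * (\<Sum>\<^sub>\<infinity>k. c k * exp (- a * (x - real_of_int k)\<^sup>2)))) UNIV"
    by (simp only:)
  then show ?thesis unfolding gauss_laurent_def by (rule infsumI)
qed

section \<open>Smoothness and vanishing of the Gaussian series\<close>

text \<open>The whole sequence of derivatives is carried along, as multiplicities need all of them.
  Boundedness controls Taylor remainders and makes averages exist; the class is stable under
  averaging.\<close>

definition smooth_bounded :: "(nat \<Rightarrow> real \<Rightarrow> real) \<Rightarrow> bool" where
  "smooth_bounded u \<longleftrightarrow> (\<forall>i x. (u i has_real_derivative u (Suc i) x) (at x)) \<and>
     (\<forall>i. \<exists>B. \<forall>x. \<bar>u i x\<bar> \<le> B)"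

lemma taylor_zero_bound:
  fixes u :: "nat \<Rightarrow> real \<Rightarrow> real"
  assumes der: "\<And>i x. (u i has_real_derivative u (Suc i) x) (at x)"
    and B: "\<And>x. \<bar>u m x\<bar> \<le> B" and zero: "\<And>i. i < m \<Longrightarrow> u i y = 0"
  shows "\<bar>u 0 x\<bar> \<le> B * \<bar>x - y\<bar> ^ m"
proof -
  have "\<exists>t. \<bar>t\<bar> \<le> \<bar>x - y\<bar> \<and> (\<lambda>z. u 0 (z + y)) (x - y) =
      (\<Sum>i<m. ((\<lambda>z. u i (z + y)) 0 / fact i) * (x - y) ^ i) + ((\<lambda>z. u m (z + y)) t / fact m) * (x - y) ^ m"
    by (rule Maclaurin_all_le) (use der in \<open>auto simp: DERIV_shift[symmetric]\<close>)
  then obtain t where "u 0 x = u m (t + y) / fact m * (x - y) ^ m"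
    using zero by auto
  then have "\<bar>u 0 x\<bar> = \<bar>u m (t + y)\<bar> / fact m * \<bar>x - y\<bar> ^ m"
    by (simp add: abs_mult power_abs)
  also have "\<dots> \<le> B / 1 * \<bar>x - y\<bar> ^ m"
    using B[of "t + y"] B[of 0] by (intro mult_right_mono frac_le) auto
  finally show ?thesis by simp
qed

text \<open>The series extends to the entire function \<open>H\<close>, whose modulus is bounded by
  a constant times \<open>exp (a * (Im z)^2)\<close>. It is thus bounded on the strip of points
  within distance 1 of the real line, and Cauchy's inequality on unit circles bounds every
  derivative there without differentiating termwise.\<close>

lemma gauss_series_smooth_bounded:
  assumes "a > 0" and c: "\<And>k. \<bar>c k\<bar> \<le> B"
  obtains u where "smooth_bounded u" "u 0 = (\<lambda>x. \<Sum>\<^sub>\<infinity>k. c k * exp (- a * (x - real_of_int k)\<^sup>2))"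
proof -
  define H where "H z = exp (- of_real a * z\<^sup>2) * gauss_laurent a c (exp (2 * of_real a * z))" for z
  obtain \<Theta> where \<Theta>: "\<And>x. (\<Sum>\<^sub>\<infinity>k::int. exp (- a * (x - real_of_int k)\<^sup>2)) \<le> \<Theta>"
    using infsum_gauss_shifts_bounded[OF assms(1)] by blast
  have "(gauss_laurent a c \<circ> (\<lambda>z. exp (2 * of_real a * z))) holomorphic_on UNIV"
    by (rule holomorphic_on_compose_gen[OF _ gauss_laurent_holomorphic[OF assms]])
       (auto intro!: holomorphic_intros)
  then have holH: "H holomorphic_on UNIV"
    unfolding H_def by (intro holomorphic_intros) (simp_all add: o_def)
  have normH: "norm (H z) \<le> B * \<Theta> * exp (a * (Im z)\<^sup>2)" for z
  proof -
    have "norm (H z) \<le> exp (- a * ((Re z)\<^sup>2 - (Im z)\<^sup>2)) * (B * \<Theta> * exp (a * (Re z)\<^sup>2))"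
      unfolding H_def norm_mult
    proof (intro mult_mono)
      show "norm (gauss_laurent a c (exp (2 * of_real a * z))) \<le> B * \<Theta> * exp (a * (Re z)\<^sup>2)"
        by (rule gauss_laurent_bound[OF assms \<Theta>]) (simp add: norm_exp_eq_Re)
    qed (auto simp: norm_exp_eq_Re power2_eq_square)
    also have "\<dots> = B * \<Theta> * exp (a * (Im z)\<^sup>2)"
      by (simp add: algebra_simps flip: exp_add)
    finally show ?thesis .
  qed
  have B: "B * \<Theta> \<ge> 0"
  proof -
    have "0 \<le> norm (H 0)" by simp
    also have "\<dots> \<le> B * \<Theta>" using normH[of 0] by simp
    finally show ?thesis .
  qed
  define u where "u i x = Re ((deriv ^^ i) H (complex_of_real x))" for i x
  have der: "(u i has_real_derivative u (Suc i) x) (at x)" for i x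
  proof -
    have "((deriv ^^ i) H has_field_derivative (deriv ^^ Suc i) H (complex_of_real x)) (at (complex_of_real x))"
      using holomorphic_derivI[OF holomorphic_higher_deriv[OF holH open_UNIV]] by simp
    then show ?thesis unfolding u_def
      by (intro has_field_derivative_Re has_vector_derivative_real_field)
  qed
  have bd: "\<exists>B. \<forall>x. \<bar>u i x\<bar> \<le> B" for i
  proof (intro exI allI)
    fix x
    have "\<bar>u i x\<bar> \<le> norm ((deriv ^^ i) H (complex_of_real x))" unfolding u_def by (rule abs_Re_le_cmod)
    also have "\<dots> \<le> fact i * (B * \<Theta> * exp a) / 1 ^ i"
    proof (rule Cauchy_inequality)
      fix z assume "norm (complex_of_real x - z) = 1"
      then have "\<bar>Im z\<bar> \<le> 1" using abs_Im_le_cmod[of "complex_of_real x - z"] by simp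
      then have "(Im z)\<^sup>2 \<le> 1" by (simp add: abs_square_le_1)
      then have "exp (a * (Im z)\<^sup>2) \<le> exp a" using assms(1) by simp
      then show "norm (H z) \<le> B * \<Theta> * exp a"
        using normH[of z] mult_left_mono[OF _ B] by (meson order_trans)
    qed (use holH in \<open>auto intro: holomorphic_on_subset holomorphic_on_imp_continuous_on\<close>)
    finally show "\<bar>u i x\<bar> \<le> fact i * (B * \<Theta> * exp a) / 1 ^ i" .
  qed
  have "u 0 x = (\<Sum>\<^sub>\<infinity>k. c k * exp (- a * (x - real_of_int k)\<^sup>2))" for x
  proof -
    have "exp (2 * of_real a * complex_of_real x) = complex_of_real (exp (2 * a * x))"
      by (simp flip: exp_of_real)
    moreover have "exp (- of_real a * (complex_of_real x)\<^sup>2) = complex_of_real (exp (- a * x\<^sup>2))"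
      by (simp flip: exp_of_real)
    ultimately have "H (complex_of_real x) = complex_of_real (exp (- a * x\<^sup>2) * (exp (a * x\<^sup>2) *
       (\<Sum>\<^sub>\<infinity>k. c k * exp (- a * (x - real_of_int k)\<^sup>2))))"
      unfolding H_def by (simp only: gauss_laurent_of_real[OF assms] of_real_mult)
    also have "exp (- a * x\<^sup>2) * (exp (a * x\<^sup>2) * (\<Sum>\<^sub>\<infinity>k. c k * exp (- a * (x - real_of_int k)\<^sup>2))) =
        (\<Sum>\<^sub>\<infinity>k. c k * exp (- a * (x - real_of_int k)\<^sup>2))"
      by (simp add: exp_minus)
    finally show ?thesis by (simp add: u_def)
  qed
  then have u0: "u 0 = (\<lambda>x. \<Sum>\<^sub>\<infinity>k. c k * exp (- a * (x - real_of_int k)\<^sup>2))" by (rule ext)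
  have "smooth_bounded u" unfolding smooth_bounded_def using der bd by blast
  then show ?thesis using u0 by (rule that)
qed

text \<open>Carries the zeros over to \<open>P\<close> by the substitution t = exp (2 a y). Windows
  of length 2 r, centred in blocks of length 2 r + 1, leave the margins 1/2 on both sides.\<close>

lemma gauss_series_vanish:
  fixes r :: real and M :: nat
  assumes "a > 0" and c: "\<And>k. \<bar>c k\<bar> \<le> B" and u: "smooth_bounded u"
    and u0: "u 0 = (\<lambda>x. \<Sum>\<^sub>\<infinity>k. c k * exp (- a * (x - real_of_int k)\<^sup>2))"
    and "r > 0" and M: "real M > 2 * r + 1"
    and zeros: "\<And>x. has_zeros u M {x - r..x + r}"
  shows "u 0 x = 0"
proof -
  obtain \<Theta> where \<Theta>: "\<And>x. (\<Sum>\<^sub>\<infinity>k::int. exp (- a * (x - real_of_int k)\<^sup>2)) \<le> \<Theta>"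
    using infsum_gauss_shifts_bounded[OF assms(1)] by blast
  define P where "P = gauss_laurent a c"
  have P_real: "P (complex_of_real (exp (2 * a * x))) = complex_of_real (exp (a * x\<^sup>2) * u 0 x)" for x
    unfolding P_def u0 by (rule gauss_laurent_of_real[OF assms(1) c])
  \<comment> \<open>Taylor's formula in x gives growth of order m at y; since x is a Lipschitz
    function of t near \<open>t0\<close>, the order persists in t.\<close>
  have order: "\<exists>B. \<forall>\<^sub>F t in at (exp (2 * a * y)). norm (P (complex_of_real t)) \<le> B * \<bar>t - exp (2 * a * y)\<bar> ^ m"
    if zero: "\<And>i. i < m \<Longrightarrow> u i y = 0" for y m
  proof -
    obtain Bm where Bm: "\<And>x. \<bar>u m x\<bar> \<le> Bm" using u unfolding smooth_bounded_def by blast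
    have taylor: "\<bar>u 0 x\<bar> \<le> Bm * \<bar>x - y\<bar> ^ m" for x
      using taylor_zero_bound[of u m Bm y x] u Bm zero unfolding smooth_bounded_def by blast
    define t0 where "t0 = exp (2 * a * y)"
    have t0: "t0 > 0" by (simp add: t0_def)
    have y: "y = ln t0 / (2 * a)" using assms(1) by (simp add: t0_def)
    \<comment> \<open>The factor \<open>exp (a * x^2)\<close> written in t; it only needs to be
      bounded near \<open>t0\<close>.\<close>
    define G where "G t = exp (a * (ln t / (2 * a))\<^sup>2)" for t
    have "(G \<longlongrightarrow> G t0) (at t0)"
      unfolding G_def by (intro tendsto_intros) (use assms(1) t0 in auto)
    then have "\<forall>\<^sub>F t in at t0. G t < G t0 + 1" by (rule order_tendstoD) simp
    moreover have "((\<lambda>t. t) \<longlongrightarrow> t0) (at t0)" by (rule tendsto_ident_at)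
    then have "\<forall>\<^sub>F t in at t0. t > t0 / 2" by (rule order_tendstoD) (use t0 in simp)
    ultimately have "\<forall>\<^sub>F t in at t0. norm (P (complex_of_real t)) \<le>
        ((G t0 + 1) * Bm / (a * t0) ^ m) * \<bar>t - t0\<bar> ^ m"
    proof eventually_elim
      case (elim t)
      have t: "t > 0" using elim(2) t0 by linarith
      define x where "x = ln t / (2 * a)"
      have tx: "t = exp (2 * a * x)" using t assms(1) by (simp add: x_def)
      \<comment> \<open>For t > t0 / 2 the logarithm has Lipschitz constant 2 / t0.\<close>
      have "\<bar>ln t - ln t0\<bar> \<le> \<bar>t - t0\<bar> / (t0 / 2)"
      proof -
        have "ln t - ln t0 \<le> (t - t0) / t0" using t t0 by (rule ln_diff_le)
        also have "\<dots> \<le> \<bar>t - t0\<bar> / (t0 / 2)" using t0 by (intro frac_le) auto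
        finally have 1: "ln t - ln t0 \<le> \<bar>t - t0\<bar> / (t0 / 2)" .
        have "ln t0 - ln t \<le> (t0 - t) / t" using t0 t by (rule ln_diff_le)
        also have "\<dots> \<le> \<bar>t - t0\<bar> / (t0 / 2)" using t0 elim(2) by (intro frac_le) auto
        finally show ?thesis using 1 by linarith
      qed
      then have "\<bar>ln t - ln t0\<bar> / (2 * a) \<le> \<bar>t - t0\<bar> / (t0 / 2) / (2 * a)"
        using assms(1) by (intro divide_right_mono) auto
      moreover have "x - y = (ln t - ln t0) / (2 * a)" by (simp add: x_def y diff_divide_distrib)
      then have "\<bar>x - y\<bar> = \<bar>ln t - ln t0\<bar> / (2 * a)" using assms(1) by (simp add: abs_divide)
      ultimately have xy: "\<bar>x - y\<bar> \<le> \<bar>t - t0\<bar> / (a * t0)"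
        by (simp add: mult_ac)
      have "norm (P (complex_of_real t)) = G t * \<bar>u 0 x\<bar>"
        by (simp add: tx P_real norm_mult) (use assms(1) in \<open>simp add: G_def\<close>)
      also have "\<dots> \<le> (G t0 + 1) * (Bm * (\<bar>t - t0\<bar> / (a * t0)) ^ m)"
      proof (intro mult_mono)
        have "Bm \<ge> 0" using Bm[of 0] by linarith
        then have "Bm * \<bar>x - y\<bar> ^ m \<le> Bm * (\<bar>t - t0\<bar> / (a * t0)) ^ m"
          by (intro mult_left_mono power_mono xy) auto
        then show "\<bar>u 0 x\<bar> \<le> Bm * (\<bar>t - t0\<bar> / (a * t0)) ^ m"
          using taylor[of x] by linarith
        show "0 \<le> G t0 + 1" by (simp add: G_def add_nonneg_nonneg)
      qed (use elim in auto)
      also have "\<dots> = ((G t0 + 1) * Bm / (a * t0) ^ m) * \<bar>t - t0\<bar> ^ m"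
        by (simp add: power_divide)
      finally show ?case .
    qed
    then show ?thesis unfolding t0_def by blast
  qed
  have P0: "P w = 0" if "w \<noteq> 0" for w
  proof (rule laurent_vanish[of P a "2 * r + 1" M "B * \<Theta>"])
    show "P holomorphic_on - {0}" unfolding P_def by (rule gauss_laurent_holomorphic[OF assms(1) c])
    show "norm (P w) \<le> B * \<Theta> * exp (a * x\<^sup>2)" if "norm w = exp (2 * a * x)" for x w
      unfolding P_def by (rule gauss_laurent_bound[OF assms(1) c \<Theta> that])
    fix k :: int
    \<comment> \<open>The midpoint of the k-th block.\<close>
    let ?x = "(real_of_int k + 1/2) * (2 * r + 1)"
    have eq: "{?x - r..?x + r} = {real_of_int k * (2 * r + 1) + 1 / 2..(real_of_int k + 1) * (2 * r + 1) - 1 / 2}"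
      by (simp add: algebra_simps)
    obtain Z where Z: "size Z = M" "set_mset Z \<subseteq> {?x - r..?x + r}" "\<And>y i. i < count Z y \<Longrightarrow> u i y = 0"
      using zeros[of ?x] unfolding has_zeros_def by blast
    show "\<exists>Z. size Z = M \<and> set_mset Z \<subseteq> {real_of_int k * (2 * r + 1) + 1 / 2..(real_of_int k + 1) * (2 * r + 1) - 1 / 2} \<and>
       (\<forall>y\<in>#Z. \<exists>B. \<forall>\<^sub>F t in at (exp (2 * a * y)).
          norm (P (complex_of_real t)) \<le> B * \<bar>t - exp (2 * a * y)\<bar> ^ count Z y)"
      using Z(1,2) order[OF Z(3)] unfolding eq by blast
  qed (use assms that in auto)
  then have "complex_of_real (exp (a * x\<^sup>2) * u 0 x) = 0" using P_real[of x] by simp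
  then show ?thesis by simp
qed

section \<open>Averages over the exponential distribution\<close>

definition exp_measure :: "real measure" where
  "exp_measure = density lborel (\<lambda>s. ennreal (exponential_density 1 s))"

text \<open>The bounded solution \<open>v\<close> of \<open>v + d v' = f\<close>; this form treats all signs of \<^term>\<open>d\<close>, and
  \<^prop>\<open>d = 0\<close>, uniformly.\<close>

definition exp_avg :: "real \<Rightarrow> (real \<Rightarrow> real) \<Rightarrow> real \<Rightarrow> real" where
  "exp_avg d f x = (\<integral>s. f (x - d * s) \<partial>exp_measure)"

interpretation exp_measure: prob_space exp_measure
  unfolding exp_measure_def by (rule prob_space_exponential_density) simp

lemma sets_exp_measure [simp, measurable_cong]: "sets exp_measure = sets borel"
  by (simp add: exp_measure_def)

lemma space_exp_measure [simp]: "space exp_measure = UNIV"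
  by (simp add: exp_measure_def)

lemma integrable_exp_avg:
  fixes f :: "real \<Rightarrow> real"
  assumes [measurable]: "f \<in> borel_measurable borel" and "\<And>x. \<bar>f x\<bar> \<le> B"
  shows "integrable exp_measure (\<lambda>s. f (x - d * s))"
  by (rule exp_measure.integrable_const_bound[of _ B]) (use assms in auto)

lemma exp_avg_bound:
  fixes f :: "real \<Rightarrow> real"
  assumes meas: "f \<in> borel_measurable borel" and B: "\<And>x. \<bar>f x\<bar> \<le> B"
  shows "\<bar>exp_avg d f x\<bar> \<le> B"
proof -
  note int = integrable_exp_avg[OF meas B]
  have "\<bar>exp_avg d f x\<bar> \<le> (\<integral>s. \<bar>f (x - d * s)\<bar> \<partial>exp_measure)"
    unfolding exp_avg_def by (rule integral_abs_bound)
  also have "\<dots> \<le> (\<integral>s. B \<partial>exp_measure)"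
    by (rule integral_mono) (use int B in auto)
  also have "\<dots> = B" using exp_measure.prob_space by simp
  finally show ?thesis .
qed

lemma smooth_bounded_measurable:
  assumes "smooth_bounded u"
  shows "u i \<in> borel_measurable borel"
proof (rule borel_measurable_continuous_onI)
  show "continuous_on UNIV (u i)"
    using assms unfolding smooth_bounded_def by (meson DERIV_isCont continuous_at_imp_continuous_on)
qed

lemma second_order_bound:
  fixes u :: "nat \<Rightarrow> real \<Rightarrow> real"
  assumes der: "\<And>i x. (u i has_real_derivative u (Suc i) x) (at x)"
    and B: "\<And>x. \<bar>u (Suc (Suc i)) x\<bar> \<le> B"
  shows "\<bar>u i (x + h) - u i x - h * u (Suc i) x\<bar> \<le> B * h\<^sup>2"
proof -
  have "\<exists>t. \<bar>t\<bar> \<le> \<bar>h\<bar> \<and> (\<lambda>z. u i (z + x)) h =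
      (\<Sum>m<2. ((\<lambda>z. u (m + i) (z + x)) 0 / fact m) * h ^ m) + ((\<lambda>z. u (2 + i) (z + x)) t / fact 2) * h ^ 2"
    by (rule Maclaurin_all_le) (use der in \<open>auto simp: DERIV_shift[symmetric]\<close>)
  then obtain t where "u i (h + x) = u i x + u (Suc i) x * h + u (Suc (Suc i)) (t + x) / 2 * h\<^sup>2"
    by (auto simp: numeral_2_eq_2)
  then have "\<bar>u i (x + h) - u i x - h * u (Suc i) x\<bar> = \<bar>u (Suc (Suc i)) (t + x)\<bar> / 2 * h\<^sup>2"
    by (simp add: abs_mult add.commute mult.commute)
  also have "\<dots> \<le> B / 1 * h\<^sup>2"
    using B[of "t + x"] B[of 0] by (intro mult_right_mono frac_le) auto
  finally show ?thesis by simp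
qed

lemma DERIV_of_second_order_bound:
  fixes F :: "real \<Rightarrow> real"
  assumes "\<And>h. \<bar>F (x + h) - F x - h * D\<bar> \<le> B * h\<^sup>2"
  shows "(F has_real_derivative D) (at x)"
proof -
  have "\<forall>\<^sub>F h in at 0. norm ((F (x + h) - F x) / h - D) \<le> B * \<bar>h\<bar>"
  proof (rule eventually_mono)
    show "\<forall>\<^sub>F h::real in at 0. h \<noteq> 0" by (simp add: eventually_at_filter)
    fix h :: real assume h: "h \<noteq> 0"
    then have "\<bar>(F (x + h) - F x) / h - D\<bar> * \<bar>h\<bar> = \<bar>F (x + h) - F x - h * D\<bar>"
      by (simp add: abs_mult[symmetric] field_simps)
    also have "\<dots> \<le> (B * \<bar>h\<bar>) * \<bar>h\<bar>" using assms[of h] by (simp add: power2_eq_square mult.assoc)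
    finally show "norm ((F (x + h) - F x) / h - D) \<le> B * \<bar>h\<bar>" using h by simp
  qed
  moreover have "((\<lambda>h::real. B * \<bar>h\<bar>) \<longlongrightarrow> 0) (at 0)"
    by (auto intro!: tendsto_eq_intros)
  ultimately have "((\<lambda>h. (F (x + h) - F x) / h - D) \<longlongrightarrow> 0) (at 0)"
    by (rule Lim_null_comparison)
  then show ?thesis unfolding DERIV_def by (simp add: Lim_null[symmetric])
qed

text \<open>Differentiation under the integral: the Taylor remainder of \<open>u i\<close> is at
  most \<open>B * h^2\<close> uniformly in s, so averaging over a probability measure preserves this
  bound.\<close>

lemma smooth_bounded_exp_avg:
  assumes u: "smooth_bounded u"
  shows "smooth_bounded (\<lambda>i. exp_avg d (u i))"
proof -
  have der: "\<And>i x. (u i has_real_derivative u (Suc i) x) (at x)"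
    and bd: "\<And>i. \<exists>B. \<forall>x. \<bar>u i x\<bar> \<le> B" using u unfolding smooth_bounded_def by auto
  note [measurable] = smooth_bounded_measurable[OF u]
  have int: "integrable exp_measure (\<lambda>s. u i (x - d * s))" for i x
    using bd[of i] integrable_exp_avg[of "u i"] smooth_bounded_measurable[OF u] by blast
  show ?thesis
    unfolding smooth_bounded_def
  proof (intro conjI allI)
    fix i
    show "\<exists>B. \<forall>x. \<bar>exp_avg d (u i) x\<bar> \<le> B"
      using bd[of i] exp_avg_bound[OF smooth_bounded_measurable[OF u]] by blast
    fix x
    obtain B where B: "\<And>x. \<bar>u (Suc (Suc i)) x\<bar> \<le> B" using bd by blast
    show "(exp_avg d (u i) has_real_derivative exp_avg d (u (Suc i)) x) (at x)"
    proof (rule DERIV_of_second_order_bound)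
      fix h
      let ?r = "\<lambda>s. u i ((x - d * s) + h) - u i (x - d * s) - h * u (Suc i) (x - d * s)"
      have eq: "(x - d * s) + h = (x + h) - d * s" for s by simp
      have intr: "integrable exp_measure ?r"
        unfolding eq by (intro Bochner_Integration.integrable_diff integrable_mult_right int)
      have "exp_avg d (u i) (x + h) - exp_avg d (u i) x - h * exp_avg d (u (Suc i)) x = (\<integral>s. ?r s \<partial>exp_measure)"
        unfolding exp_avg_def eq using int by (simp add: Bochner_Integration.integrable_diff)
      then have "\<bar>exp_avg d (u i) (x + h) - exp_avg d (u i) x - h * exp_avg d (u (Suc i)) x\<bar> \<le>
          (\<integral>s. \<bar>?r s\<bar> \<partial>exp_measure)" by (simp only: integral_abs_bound)
      also have "\<dots> \<le> (\<integral>s. B * h\<^sup>2 \<partial>exp_measure)"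
        by (rule integral_mono) (use intr second_order_bound[OF der B] in auto)
      also have "\<dots> = B * h\<^sup>2" using exp_measure.prob_space by simp
      finally show "\<bar>exp_avg d (u i) (x + h) - exp_avg d (u i) x - h * exp_avg d (u (Suc i)) x\<bar> \<le> B * h\<^sup>2" .
    qed
  qed
qed

text \<open>In the variable s, \<open>exp (- s) * (f (x - d * s) + d * f' (x - d * s))\<close> is
  the derivative of \<open>- exp (- s) * f (x - d * s)\<close>, which runs from \<open>- f x\<close>
  at 0 to 0 at infinity.\<close>

lemma exp_avg_add_deriv:
  fixes f f' :: "real \<Rightarrow> real"
  assumes der: "\<And>x. (f has_real_derivative f' x) (at x)"
    and cont: "continuous_on UNIV f'" and B: "\<And>x. \<bar>f x\<bar> \<le> B" and B': "\<And>x. \<bar>f' x\<bar> \<le> B'"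
  shows "exp_avg d f x + d * exp_avg d f' x = f x"
proof -
  have contf: "continuous_on UNIV f"
    using der by (meson DERIV_isCont continuous_at_imp_continuous_on)
  have isc: "isCont f y" "isCont f' y" for y
    using contf cont by (auto simp: continuous_on_eq_continuous_at)
  have meas [measurable]: "f \<in> borel_measurable borel" "f' \<in> borel_measurable borel"
    using contf cont by (auto intro: borel_measurable_continuous_onI)
  define w where "w s = f (x - d * s) + d * f' (x - d * s)" for s
  have [measurable]: "w \<in> borel_measurable borel" unfolding w_def by measurable
  note int = integrable_exp_avg[OF meas(1) B, of x d] integrable_exp_avg[OF meas(2) B', of x d]
  have intw: "integrable exp_measure w"
    unfolding w_def using int by (intro Bochner_Integration.integrable_add integrable_mult_right)
  have "exp_avg d f x + d * exp_avg d f' x = (\<integral>s. w s \<partial>exp_measure)"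
    unfolding exp_avg_def w_def using int by simp
  also have "\<dots> = (\<integral>s. exponential_density 1 s *\<^sub>R w s \<partial>lborel)"
    unfolding exp_measure_def by (rule integral_density) (auto simp: exponential_density_nonneg)
  \<comment> \<open>The integrands differ only at s = 0, a null set.\<close>
  also have "\<dots> = (\<integral>s. indicator {0<..} s *\<^sub>R (exp (- s) * w s) \<partial>lborel)"
    by (rule integral_cong_AE)
       (use AE_lborel_singleton[of "0::real"] in \<open>auto simp: exponential_density_def indicator_def elim!: eventually_mono\<close>)
  also have "\<dots> = (LBINT s=0..\<infinity>. exp (- s) * w s)"
    by (simp add: interval_lebesgue_integral_0_infty set_lebesgue_integral_def)
  also have "\<dots> = 0 - (- f x)"
  proof (rule interval_integral_FTC_integrable[where F = "\<lambda>s. - exp (- s) * f (x - d * s)"])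
    show "((\<lambda>s. - exp (- s) * f (x - d * s)) has_vector_derivative exp (- s) * w s) (at s)" for s
      unfolding has_real_derivative_iff_has_vector_derivative[symmetric]
      by (rule derivative_eq_intros DERIV_chain2[OF der] refl | simp add: w_def algebra_simps)+
    show "isCont (\<lambda>s. exp (- s) * w s) s" for s
      unfolding w_def by (intro continuous_intros isCont_o2[OF _ isc(1)] isCont_o2[OF _ isc(2)])
    have "integrable lborel (\<lambda>s. exponential_density 1 s *\<^sub>R w s)"
      using intw unfolding exp_measure_def
      by (subst (asm) integrable_density) (auto simp: exponential_density_nonneg)
    moreover have "integrable lborel (\<lambda>s. exponential_density 1 s *\<^sub>R w s) \<longleftrightarrow>
        integrable lborel (\<lambda>s. indicator {0<..} s *\<^sub>R (exp (- s) * w s))"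
      by (rule integrable_cong_AE)
         (use AE_lborel_singleton[of "0::real"] in \<open>auto simp: exponential_density_def indicator_def elim!: eventually_mono\<close>)
    moreover have "einterval 0 \<infinity> = {0::real<..}" by (auto simp: einterval_def zero_ereal_def)
    ultimately show "set_integrable lborel (einterval 0 \<infinity>) (\<lambda>s. exp (- s) * w s)"
      by (simp add: set_integrable_def)
    have "((\<lambda>s. - exp (- s) * f (x - d * s)) \<longlongrightarrow> - exp (- 0) * f (x - d * 0)) (at_right 0)"
      by (intro tendsto_intros isCont_tendsto_compose[OF isc(1)])
    then show "(((\<lambda>s. - exp (- s) * f (x - d * s)) \<circ> real_of_ereal) \<longlongrightarrow> - f x) (at_right 0)"
      unfolding zero_ereal_def by (simp add: ereal_tendsto_simps1)
    have "((\<lambda>s. - exp (- s) * f (x - d * s)) \<longlongrightarrow> 0) at_top"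
    proof (rule Lim_null_comparison)
      have "norm (- exp (- s) * f (x - d * s)) \<le> exp (- s) * B" for s
        by (simp add: abs_mult B)
      then show "\<forall>\<^sub>F s in at_top. norm (- exp (- s) * f (x - d * s)) \<le> exp (- s) * B" by simp
      show "((\<lambda>s. exp (- s) * B) \<longlongrightarrow> 0) at_top" by real_asymp
    qed
    then show "(((\<lambda>s. - exp (- s) * f (x - d * s)) \<circ> real_of_ereal) \<longlongrightarrow> 0) (at_left \<infinity>)"
      by (simp add: ereal_tendsto_simps1)
  qed simp
  finally show ?thesis by simp
qed

lemma borel_measurable_cis [measurable]: "cis \<in> borel_measurable borel"
  by (intro borel_measurable_continuous_onI continuous_intros)

text \<open>The characteristic function of the exponential distribution, and thereby the Fourier
  multiplier of \<open>exp_avg\<close>.\<close>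

lemma exp_measure_cis: "(\<integral>s. cis (- (d * s)) \<partial>exp_measure) = inverse (1 + \<i> * complex_of_real d)"
proof -
  \<comment> \<open>The identity \<open>v + d v' = f\<close> for \<open>f = cos\<close> and \<open>f = sin\<close> gives two linear equations for \<open>C\<close> and \<open>S\<close>.\<close>
  define C where "C = (\<integral>s. cos (d * s) \<partial>exp_measure)"
  define S where "S = (\<integral>s. sin (d * s) \<partial>exp_measure)"
  have C: "exp_avg d cos 0 = C" and S: "exp_avg d sin 0 = - S"
    by (simp_all add: exp_avg_def C_def S_def)
  have "exp_avg d cos 0 + d * exp_avg d (\<lambda>x. - sin x) 0 = cos 0"
    by (rule exp_avg_add_deriv[where B = 1 and B' = 1]) (auto intro!: derivative_eq_intros continuous_intros)
  moreover have "exp_avg d (\<lambda>x. - sin x) 0 = S" by (simp add: exp_avg_def S_def)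
  ultimately have 1: "C + d * S = 1" using C by simp
  have "exp_avg d sin 0 + d * exp_avg d cos 0 = sin 0"
    by (rule exp_avg_add_deriv[where B = 1 and B' = 1]) (auto intro!: derivative_eq_intros continuous_intros)
  then have 2: "S = d * C" using C S by simp
  have int: "integrable exp_measure (\<lambda>s. cis (- (d * s)))"
    by (rule exp_measure.integrable_const_bound[of _ 1]) auto
  have "Re (\<integral>s. cis (- (d * s)) \<partial>exp_measure) = C" "Im (\<integral>s. cis (- (d * s)) \<partial>exp_measure) = - S"
    using integral_Re[OF int] integral_Im[OF int] by (simp_all add: C_def S_def)
  then have eq: "(\<integral>s. cis (- (d * s)) \<partial>exp_measure) = Complex C (- S)" by (simp add: complex_eq_iff)
  have "Complex C (- S) * (1 + \<i> * complex_of_real d) = 1"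
    using 1 2 by (simp add: complex_eq_iff algebra_simps)
  then show ?thesis unfolding eq by (metis inverse_unique mult.commute)
qed

section \<open>Fourier transforms\<close>

interpretation exp_lborel: pair_sigma_finite exp_measure lborel ..

lemma lborel_integral_translate:
  fixes f :: "real \<Rightarrow> 'a :: {banach, second_countable_topology}"
  shows "(\<integral>x. f (x - t) \<partial>lborel) = (\<integral>x. f x \<partial>lborel)"
  using lborel_integral_real_affine[of 1 f "- t"] by (simp add: algebra_simps)

lemma lborel_integrable_translate:
  fixes f :: "real \<Rightarrow> 'a :: {banach, second_countable_topology}"
  shows "integrable lborel f \<Longrightarrow> integrable lborel (\<lambda>x. f (x - t))"
  using lborel_integrable_real_affine[of f 1 "- t"] by (simp add: algebra_simps)

text \<open>Covers two uses of Fubini: e = 1 for integrability of the average, and e = cis for its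
  Fourier transform.\<close>

lemma integrable_translates_times_bounded:
  fixes f :: "real \<Rightarrow> real" and e :: "real \<Rightarrow> complex"
  assumes meas [measurable]: "f \<in> borel_measurable borel" "e \<in> borel_measurable borel"
    and f: "integrable lborel f" and e: "\<And>x. norm (e x) = 1"
  shows "integrable (exp_measure \<Otimes>\<^sub>M lborel) (\<lambda>(s, x). complex_of_real (f (x - d * s)) * e x)"
proof (rule exp_lborel.Fubini_integrable)
  show "(\<lambda>(s, x). complex_of_real (f (x - d * s)) * e x) \<in> borel_measurable (exp_measure \<Otimes>\<^sub>M lborel)"
    by measurable
  have "integrable exp_measure (\<lambda>s. \<integral>x. \<bar>f (x - d * s)\<bar> \<partial>lborel)"
    using lborel_integral_translate[of "\<lambda>x. \<bar>f x\<bar>"] by simp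
  then show "integrable exp_measure (\<lambda>s. \<integral>x. norm (case (s, x) of (s, x) \<Rightarrow> complex_of_real (f (x - d * s)) * e x) \<partial>lborel)"
    by (simp add: norm_mult e)
  have "integrable lborel (\<lambda>x. complex_of_real (f (x - d * s)) * e x)" for s
  proof (rule Bochner_Integration.integrable_bound)
    show "integrable lborel (\<lambda>x. f (x - d * s))" by (rule lborel_integrable_translate[OF f])
  qed (auto simp: norm_mult e)
  then show "AE s in exp_measure. integrable lborel (\<lambda>x. case (s, x) of (s, x) \<Rightarrow> complex_of_real (f (x - d * s)) * e x)"
    by simp
qed

text \<open>Translation by d s multiplies the transform by the phase
  \<open>cis (- (2 * pi * d * \<xi> * s))\<close>; averaging over s leaves the characteristic
  function of the exponential distribution at \<open>2 * pi * d * \<xi>\<close>.\<close>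

lemma
  fixes f :: "real \<Rightarrow> real"
  assumes meas [measurable]: "f \<in> borel_measurable borel" and f: "integrable lborel f"
  shows integrable_lborel_exp_avg: "integrable lborel (exp_avg d f)"
    and fourier_exp_avg: "fourier (exp_avg d f) \<xi> =
          inverse (1 + 2 * pi * \<i> * complex_of_real (d * \<xi>)) * fourier f \<xi>"
proof -
  have "integrable lborel (\<lambda>x. \<integral>s. complex_of_real (f (x - d * s)) * 1 \<partial>exp_measure)"
    by (rule exp_lborel.integrable_snd)
       (rule integrable_translates_times_bounded[OF meas _ f, where e = "\<lambda>_. 1"], auto)
  then show "integrable lborel (exp_avg d f)"
    by (simp add: exp_avg_def[abs_def] complex_of_real_integrable_eq)
  let ?F = "\<lambda>s x. complex_of_real (f (x - d * s)) * cis (- 2 * pi * x * \<xi>)"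
  have "fourier (exp_avg d f) \<xi> = (\<integral>x. (\<integral>s. ?F s x \<partial>exp_measure) \<partial>lborel)"
    unfolding fourier_def exp_avg_def by simp
  also have "\<dots> = (\<integral>s. (\<integral>x. ?F s x \<partial>lborel) \<partial>exp_measure)"
    by (rule exp_lborel.Fubini_integral)
       (rule integrable_translates_times_bounded[OF meas _ f], auto)
  also have "\<dots> = (\<integral>s. cis (- (2 * pi * d * \<xi> * s)) * fourier f \<xi> \<partial>exp_measure)"
  proof (rule Bochner_Integration.integral_cong[OF refl])
    fix s
    have "?F s x = cis (- (2 * pi * d * \<xi> * s)) *
        (complex_of_real (f (x - d * s)) * cis (- 2 * pi * (x - d * s) * \<xi>))" for x
    proof -
      have "- 2 * pi * x * \<xi> = - (2 * pi * d * \<xi> * s) + - 2 * pi * (x - d * s) * \<xi>"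
        by (simp add: algebra_simps)
      then have "cis (- 2 * pi * x * \<xi>) = cis (- (2 * pi * d * \<xi> * s)) * cis (- 2 * pi * (x - d * s) * \<xi>)"
        by (simp only: cis_mult)
      then show ?thesis by (simp add: mult_ac)
    qed
    then have "(\<integral>x. ?F s x \<partial>lborel) = cis (- (2 * pi * d * \<xi> * s)) *
        (\<integral>x. complex_of_real (f (x - d * s)) * cis (- 2 * pi * (x - d * s) * \<xi>) \<partial>lborel)"
      by (simp only: integral_mult_right_zero)
    then show "(\<integral>x. ?F s x \<partial>lborel) = cis (- (2 * pi * d * \<xi> * s)) * fourier f \<xi>"
      unfolding fourier_def
      using lborel_integral_translate[of "\<lambda>x. complex_of_real (f x) * cis (- 2 * pi * x * \<xi>)" "d * s"] by simp
  qed
  also have "\<dots> = inverse (1 + \<i> * complex_of_real (2 * pi * d * \<xi>)) * fourier f \<xi>"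
    by (simp only: integral_mult_left_zero exp_measure_cis)
  also have "\<i> * complex_of_real (2 * pi * d * \<xi>) = 2 * pi * \<i> * complex_of_real (d * \<xi>)"
    by simp
  finally show "fourier (exp_avg d f) \<xi> = inverse (1 + 2 * pi * \<i> * complex_of_real (d * \<xi>)) * fourier f \<xi>" .
qed

section \<open>Uniqueness of the Fourier transform, and the Gaussian\<close>

lemma continuous_AE_zero:
  fixes f :: "real \<Rightarrow> real"
  assumes "continuous_on UNIV f" "AE x in lborel. f x = 0"
  shows "f x = 0"
proof (rule ccontr)
  assume "f x \<noteq> 0"
  have op: "open (f -` (- {0}))" using assms(1) by (intro open_vimage) auto
  with \<open>f x \<noteq> 0\<close> obtain e where e: "e > 0" "ball x e \<subseteq> f -` (- {0})"
    by (metis ComplI openE singletonD vimageI)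
  have "ball x e \<in> null_sets lborel"
  proof -
    have "AE y in lborel. y \<notin> ball x e" using assms(2) e(2) by (auto elim!: eventually_mono)
    then show ?thesis by (subst AE_iff_null_sets) auto
  qed
  then have "emeasure lborel (ball x e) = 0" by auto
  then show False using e(1) by (simp add: ball_eq_greaterThanLessThan)
qed

text \<open>Reduced to Levy's uniqueness theorem for probability measures, which is why
  \<open>f\<close> is split into its positive and negative parts \<open>p\<close> and
  \<open>n\<close>.\<close>

lemma fourier_eq_0_imp_eq_0:
  fixes f :: "real \<Rightarrow> real"
  assumes cont: "continuous_on UNIV f" and f: "integrable lborel f" and F0: "\<And>\<xi>. fourier f \<xi> = 0"
  shows "f x = 0"
proof -
  have [measurable]: "f \<in> borel_measurable borel" using cont by (rule borel_measurable_continuous_onI)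
  define p where "p x = max 0 (f x)" for x
  define n where "n x = max 0 (- f x)" for x
  have [measurable]: "p \<in> borel_measurable borel" "n \<in> borel_measurable borel"
    unfolding p_def n_def by measurable
  have nonneg: "p x \<ge> 0" "n x \<ge> 0" for x by (auto simp: p_def n_def)
  have fpn: "f x = p x - n x" for x by (auto simp: p_def n_def)
  have intp: "integrable lborel p" unfolding p_def using f by simp
  have intn: "integrable lborel n" unfolding n_def using f by simp
  have int_cis: "integrable lborel (\<lambda>x. complex_of_real (q x) * cis (t * x))"
    if [measurable]: "q \<in> borel_measurable borel" and "integrable lborel q" for q t
    by (rule Bochner_Integration.integrable_bound[OF that(2)]) (auto simp: norm_mult)
  have eq: "(\<integral>x. complex_of_real (p x) * cis (t * x) \<partial>lborel) = (\<integral>x. complex_of_real (n x) * cis (t * x) \<partial>lborel)" for t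
  proof -
    \<comment> \<open>This argument translates the phase \<open>cis (- 2 * pi * x * \<xi>)\<close>
      into the phase \<open>cis (t * x)\<close> of characteristic functions.\<close>
    have "0 = fourier f (- t / (2 * pi))" by (simp add: F0)
    also have "\<dots> = (\<integral>x. complex_of_real (p x) * cis (t * x) - complex_of_real (n x) * cis (t * x) \<partial>lborel)"
      unfolding fourier_def by (intro Bochner_Integration.integral_cong refl) (simp add: fpn algebra_simps)
    also have "\<dots> = (\<integral>x. complex_of_real (p x) * cis (t * x) \<partial>lborel) - (\<integral>x. complex_of_real (n x) * cis (t * x) \<partial>lborel)"
      by (intro Bochner_Integration.integral_diff int_cis intp intn) auto
    finally show ?thesis by simp
  qed
  \<comment> \<open>After normalisation the positive and negative parts are probability densities with the same
      characteristic function.\<close>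
  define I where "I = (\<integral>x. p x \<partial>lborel)"
  \<comment> \<open>At t = 0 the transforms are the total masses.\<close>
  have In: "I = (\<integral>x. n x \<partial>lborel)"
    using eq[of 0] by (simp add: I_def)
  have "I \<ge> 0" unfolding I_def by (simp add: nonneg)
  have "AE x in lborel. f x = 0"
  proof (cases "I = 0")
    \<comment> \<open>Mass 0 cannot be normalised, but then both parts vanish almost
      everywhere.\<close>
    case True
    have "AE x in lborel. p x = 0" "AE x in lborel. n x = 0"
      using True In integral_nonneg_eq_0_iff_AE[OF intp] integral_nonneg_eq_0_iff_AE[OF intn] nonneg
      by (auto simp: I_def)
    then show ?thesis by eventually_elim (simp add: fpn)
  next
    case False
    with \<open>I \<ge> 0\<close> have I: "I > 0" by simp
    have dist: "real_distribution (density lborel (\<lambda>x. ennreal (q x / I)))"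
      if [measurable]: "q \<in> borel_measurable borel" and q: "integrable lborel q" "\<And>x. q x \<ge> 0"
        "(\<integral>x. q x \<partial>lborel) = I" for q
    proof -
      have "(\<integral>\<^sup>+ x. ennreal (q x / I) \<partial>lborel) = ennreal (\<integral>x. q x / I \<partial>lborel)"
        by (rule nn_integral_eq_integral) (use q I in auto)
      also have "\<dots> = 1" using q(3) I by simp
      finally have "(\<integral>\<^sup>+ x. ennreal (q x / I) \<partial>lborel) = 1" .
      then have "prob_space (density lborel (\<lambda>x. ennreal (q x / I)))"
        by (intro prob_spaceI) (simp add: emeasure_density)
      then show ?thesis
        unfolding real_distribution_def real_distribution_axioms_def by simp
    qed
    have char: "char (density lborel (\<lambda>x. ennreal (q x / I))) t =
        (\<integral>x. complex_of_real (q x) * cis (t * x) \<partial>lborel) / I"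
      if [measurable]: "q \<in> borel_measurable borel" and q: "\<And>x. q x \<ge> 0" for q t
    proof -
      have "char (density lborel (\<lambda>x. ennreal (q x / I))) t = (\<integral>x. (q x / I) *\<^sub>R cis (t * x) \<partial>lborel)"
        unfolding char_def cis_conv_exp[symmetric] by (rule integral_density) (use q I in auto)
      also have "\<dots> = (\<integral>x. complex_of_real (q x) * cis (t * x) / I \<partial>lborel)"
        by (simp add: scaleR_conv_of_real)
      finally show ?thesis by simp
    qed
    have "density lborel (\<lambda>x. ennreal (p x / I)) = density lborel (\<lambda>x. ennreal (n x / I))"
    proof (rule Levy_uniqueness)
      show "char (density lborel (\<lambda>x. ennreal (p x / I))) = char (density lborel (\<lambda>x. ennreal (n x / I)))"
        by (rule ext) (simp add: char nonneg eq)
    qed (auto intro!: dist intp intn simp: nonneg I_def[symmetric] In[symmetric])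
    then have "AE x in lborel. ennreal (p x / I) = ennreal (n x / I)"
      by (subst (asm) sigma_finite_measure.density_unique_iff[OF sigma_finite_lborel]) auto
    then show ?thesis
    proof eventually_elim
      case (elim x)
      then have "p x / I = n x / I" using nonneg I by (subst (asm) ennreal_inj) auto
      then show ?case using I by (simp add: fpn)
    qed
  qed
  then show ?thesis by (rule continuous_AE_zero[OF cont])
qed

text \<open>\<phi> is the centred normal density with standard deviation 1 / \<kappa>, so its
  transform is a rescaled standard normal characteristic function.\<close>

lemma
  fixes c :: real
  assumes "c > 0"
  defines "\<phi> \<equiv> \<lambda>x. sqrt (pi / c) * exp (- (pi\<^sup>2 / c) * x\<^sup>2)"
  shows integrable_gauss: "integrable lborel \<phi>"
    and fourier_gauss: "fourier \<phi> \<xi> = complex_of_real (exp (- c * \<xi>\<^sup>2))"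
proof -
  define \<kappa> where "\<kappa> = pi * sqrt (2 / c)"
  have \<kappa>: "\<kappa> > 0" using assms(1) by (simp add: \<kappa>_def)
  have \<kappa>2: "\<kappa>\<^sup>2 = 2 * pi\<^sup>2 / c" using assms(1) by (simp add: \<kappa>_def power_mult_distrib)
  have sq: "\<kappa> / sqrt (2 * pi) = sqrt (pi / c)"
    unfolding \<kappa>_def using assms(1)
    by (simp add: real_sqrt_divide real_sqrt_mult field_simps)
  have \<phi>: "\<phi> x = \<kappa> * std_normal_density (0 + \<kappa> * x)" for x
  proof -
    have "(\<kappa> * x)\<^sup>2 / 2 = pi\<^sup>2 / c * x\<^sup>2" by (simp add: power_mult_distrib \<kappa>2)
    then show ?thesis unfolding \<phi>_def sq[symmetric] by (simp add: std_normal_density_def)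
  qed
  have "integrable lborel (\<lambda>x. std_normal_density (0 + \<kappa> * x))"
    using \<kappa> by (intro lborel_integrable_real_affine) (auto simp: integrable_normal_density)
  then show "integrable lborel \<phi>" unfolding \<phi>[abs_def] by (intro integrable_mult_right)
  \<comment> \<open>Chosen so that \<open>t * \<kappa> = - 2 * pi * \<xi>\<close>; then
    \<open>t^2 / 2 = c * \<xi>^2\<close>.\<close>
  define t where "t = - 2 * pi * \<xi> / \<kappa>"
  have "(\<integral>x. std_normal_density x *\<^sub>R cis (t * x) \<partial>lborel) = char std_normal_distribution t"
    unfolding char_def cis_conv_exp[symmetric]
    by (rule integral_density[symmetric]) auto
  also have "\<dots> = complex_of_real (exp (- (t\<^sup>2) / 2))" by (simp add: char_std_normal_distribution)
  also have "t\<^sup>2 = 2 * (c * \<xi>\<^sup>2)"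
    using assms(1) by (simp add: t_def power_divide power_mult_distrib \<kappa>2 field_simps)
  finally have *: "(\<integral>x. std_normal_density x *\<^sub>R cis (t * x) \<partial>lborel) = complex_of_real (exp (- c * \<xi>\<^sup>2))"
    by simp
  have "(\<integral>x. std_normal_density x *\<^sub>R cis (t * x) \<partial>lborel) =
      \<bar>\<kappa>\<bar> *\<^sub>R (\<integral>x. std_normal_density (0 + \<kappa> * x) *\<^sub>R cis (t * (0 + \<kappa> * x)) \<partial>lborel)"
    by (rule lborel_integral_real_affine) (use \<kappa> in auto)
  also have "\<dots> = (\<integral>x. \<bar>\<kappa>\<bar> *\<^sub>R (std_normal_density (0 + \<kappa> * x) *\<^sub>R cis (t * (0 + \<kappa> * x))) \<partial>lborel)"
    by (simp only: integral_scaleR_right)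
  also have "\<dots> = fourier \<phi> \<xi>"
    unfolding fourier_def \<phi> using \<kappa>
    by (intro Bochner_Integration.integral_cong refl) (simp add: t_def scaleR_conv_of_real mult_ac)
  finally show "fourier \<phi> \<xi> = complex_of_real (exp (- c * \<xi>\<^sup>2))" using * by simp
qed

section \<open>Shift-invariant spaces of totally positive generators\<close>

text \<open>Controls the periodisation of f without any decay rate. Being stated by finite sums, it
  passes through an average by linearity, and it yields both summability of the shifts and
  boundedness of f.\<close>

definition shift_bounded :: "(real \<Rightarrow> real) \<Rightarrow> real \<Rightarrow> bool" where
  "shift_bounded f C \<longleftrightarrow> (\<forall>x. 0 \<le> f x) \<and>
     (\<forall>x F. finite F \<longrightarrow> (\<Sum>k\<in>F. f (x - real_of_int k)) \<le> C)"

lemma shift_bounded_abs_le: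
  assumes "shift_bounded f C"
  shows "\<bar>f x\<bar> \<le> C"
proof -
  have "(\<Sum>k\<in>{0::int}. f (x - real_of_int k)) \<le> C" using assms unfolding shift_bounded_def by blast
  then show ?thesis using assms by (simp add: shift_bounded_def)
qed

lemma shift_bounded_summable:
  assumes "shift_bounded f C"
  shows "(\<lambda>k. f (x - real_of_int k)) summable_on UNIV"
proof (rule nonneg_bdd_above_summable_on)
  show "bdd_above (sum (\<lambda>k. f (x - real_of_int k)) ` {F. F \<subseteq> UNIV \<and> finite F})"
    using assms by (intro bdd_aboveI[of _ C]) (auto simp: shift_bounded_def)
qed (use assms in \<open>auto simp: shift_bounded_def\<close>)

lemma shift_bounded_exp_avg:
  assumes [measurable]: "f \<in> borel_measurable borel" and f: "shift_bounded f C"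
  shows "shift_bounded (exp_avg d f) C"
  unfolding shift_bounded_def
proof (intro conjI allI impI)
  have nonneg: "\<And>x. 0 \<le> f x" using f by (simp add: shift_bounded_def)
  then show "0 \<le> exp_avg d f x" for x by (simp add: exp_avg_def)
  fix x and F :: "int set" assume F: "finite F"
  have int: "integrable exp_measure (\<lambda>s. f (x - real_of_int k - d * s))" for k
    by (rule integrable_exp_avg[OF assms(1) shift_bounded_abs_le[OF f]])
  have "(\<Sum>k\<in>F. exp_avg d f (x - real_of_int k)) = (\<integral>s. (\<Sum>k\<in>F. f (x - real_of_int k - d * s)) \<partial>exp_measure)"
    unfolding exp_avg_def using int by (subst Bochner_Integration.integral_sum) auto
  also have "\<dots> \<le> (\<integral>s. C \<partial>exp_measure)"
  proof (rule integral_mono)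
    show "(\<Sum>k\<in>F. f (x - real_of_int k - d * s)) \<le> C" for s
    proof -
      have "(\<Sum>k\<in>F. f ((x - d * s) - real_of_int k)) \<le> C" using f F unfolding shift_bounded_def by blast
      then show ?thesis by (simp add: algebra_simps)
    qed
  qed (use int in auto)
  also have "\<dots> = C" using exp_measure.prob_space by simp
  finally show "(\<Sum>k\<in>F. exp_avg d f (x - real_of_int k)) \<le> C" .
qed

text \<open>Turns series into integrals over the counting measure, so that Fubini's theorem can
  exchange them with averages.\<close>

lemma
  fixes f :: "'a \<Rightarrow> real"
  assumes "f summable_on A"
  shows integrable_count_space_of_summable_on: "integrable (count_space A) f"
    and integral_count_space_eq_infsum: "(\<integral>k. f k \<partial>count_space A) = infsum f A"
proof -
  have "Infinite_Set_Sum.abs_summable_on f A"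
    by (rule abs_summable_equivalent[THEN iffD1, OF summable_on_iff_abs_summable_on_real[THEN iffD1, OF assms]])
  then show "integrable (count_space A) f" "(\<integral>k. f k \<partial>count_space A) = infsum f A"
    using infsetsum_infsum by (auto simp: abs_summable_on_def infsetsum_def)
qed

text \<open>Fubini applies because the averaged generator is itself \<open>shift_bounded\<close>, so
  the integrals of the absolute values are summable over k.\<close>

lemma exp_avg_infsum:
  assumes meas [measurable]: "f \<in> borel_measurable borel" and f: "shift_bounded f C"
    and c: "\<And>k. \<bar>c k\<bar> \<le> B"
  shows "exp_avg d (\<lambda>x. \<Sum>\<^sub>\<infinity>k. c k * f (x - real_of_int k)) x = (\<Sum>\<^sub>\<infinity>k. c k * exp_avg d f (x - real_of_int k))"
proof -
  interpret E: pair_sigma_finite "count_space (UNIV :: int set)" exp_measure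
    by (intro pair_sigma_finite.intro sigma_finite_measure_count_space exp_measure.sigma_finite_measure_axioms)
  have f0: "0 \<le> f x" for x using f by (simp add: shift_bounded_def)
  note Tf = shift_bounded_exp_avg[OF meas f, of d]
  have Tf0: "0 \<le> exp_avg d f x" for x using Tf by (simp add: shift_bounded_def)
  have int: "integrable exp_measure (\<lambda>s. f (y - d * s))" for y
    by (rule integrable_exp_avg[OF meas shift_bounded_abs_le[OF f]])
  let ?F = "\<lambda>k s. c k * f (x - real_of_int k - d * s)"
  have "integrable (count_space UNIV \<Otimes>\<^sub>M exp_measure) (case_prod ?F)"
  proof (rule E.Fubini_integrable)
    show "case_prod ?F \<in> borel_measurable (count_space UNIV \<Otimes>\<^sub>M exp_measure)"
      by (rule measurable_pair_measure_countable1) auto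
    have eq: "(\<integral>s. norm (case (k, s) of (k, s) \<Rightarrow> ?F k s) \<partial>exp_measure) = \<bar>c k\<bar> * exp_avg d f (x - real_of_int k)" for k
      by (simp add: abs_mult f0 exp_avg_def)
    have "(\<lambda>k. \<bar>c k\<bar> * exp_avg d f (x - real_of_int k)) summable_on UNIV"
      by (rule summable_on_bounded_mult[OF shift_bounded_summable[OF Tf] Tf0, of _ B]) (simp add: c)
    then show "integrable (count_space UNIV) (\<lambda>k. \<integral>s. norm (case (k, s) of (k, s) \<Rightarrow> ?F k s) \<partial>exp_measure)"
      unfolding eq by (rule integrable_count_space_of_summable_on)
    show "AE k in count_space UNIV. integrable exp_measure (\<lambda>s. case (k, s) of (k, s) \<Rightarrow> ?F k s)"
      using int by simp
  qed
  note fub = E.Fubini_integral[OF this]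
  have "exp_avg d (\<lambda>x. \<Sum>\<^sub>\<infinity>k. c k * f (x - real_of_int k)) x = (\<integral>s. (\<integral>k. ?F k s \<partial>count_space UNIV) \<partial>exp_measure)"
    unfolding exp_avg_def
  proof (rule Bochner_Integration.integral_cong[OF refl])
    fix s
    have "(\<lambda>k. c k * f (x - d * s - real_of_int k)) summable_on UNIV"
      by (rule summable_on_bounded_mult[OF shift_bounded_summable[OF f] f0 c])
    from integral_count_space_eq_infsum[OF this]
    show "(\<Sum>\<^sub>\<infinity>k. c k * f (x - d * s - real_of_int k)) = (\<integral>k. ?F k s \<partial>count_space UNIV)"
      by (simp add: algebra_simps)
  qed
  also have "\<dots> = (\<integral>k. c k * exp_avg d f (x - real_of_int k) \<partial>count_space UNIV)"
    unfolding fub by (simp add: exp_avg_def)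
  also have "\<dots> = (\<Sum>\<^sub>\<infinity>k. c k * exp_avg d f (x - real_of_int k))"
    by (rule integral_count_space_eq_infsum)
       (rule summable_on_bounded_mult[OF shift_bounded_summable[OF Tf] Tf0 c])
  finally show ?thesis .
qed

section \<open>Iterated averages and the structure of the generator\<close>

primrec exp_avgs :: "(nat \<Rightarrow> real) \<Rightarrow> nat \<Rightarrow> (real \<Rightarrow> real) \<Rightarrow> real \<Rightarrow> real" where
  "exp_avgs \<delta> 0 f = f"
| "exp_avgs \<delta> (Suc n) f = exp_avg (\<delta> n) (exp_avgs \<delta> n f)"

lemma smooth_bounded_exp_avgs: "smooth_bounded u \<Longrightarrow> smooth_bounded (\<lambda>i. exp_avgs \<delta> n (u i))"
  by (induction n) (auto intro: smooth_bounded_exp_avg)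

lemma exp_avgs_measurable:
  assumes "smooth_bounded u"
  shows "exp_avgs \<delta> n (u i) \<in> borel_measurable borel"
  using smooth_bounded_measurable[OF smooth_bounded_exp_avgs[OF assms]] .

lemma exp_avgs_zero: "exp_avgs \<delta> n (\<lambda>x. 0) = (\<lambda>x. 0)"
  by (induction n) (auto simp: exp_avg_def)

text \<open>Undoing each of the n averages by its differential operator costs at most one zero per
  interval, whence \<open>M + n\<close>.\<close>

lemma has_zeros_exp_avgs:
  assumes u: "smooth_bounded u"
  shows "has_zeros (\<lambda>i. exp_avgs \<delta> n (u i)) (M + n) {a..b} \<Longrightarrow> has_zeros u M {a..b}"
proof (induction n)
  case (Suc n)
  let ?v = "\<lambda>i. exp_avgs \<delta> n (u i)"
  have v: "smooth_bounded ?v" by (rule smooth_bounded_exp_avgs[OF u])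
  have "has_zeros (\<lambda>i x. exp_avgs \<delta> (Suc n) (u i) x + \<delta> n * exp_avgs \<delta> (Suc n) (u (Suc i)) x) (M + n) {a..b}"
    using smooth_bounded_exp_avgs[OF u, of \<delta> "Suc n"] Suc.prems
    by (intro has_zeros_add_deriv) (auto simp: smooth_bounded_def)
  \<comment> \<open>The operator inverts the outermost average, at the level of every
    derivative.\<close>
  also have "(\<lambda>i x. exp_avgs \<delta> (Suc n) (u i) x + \<delta> n * exp_avgs \<delta> (Suc n) (u (Suc i)) x) = ?v"
  proof (intro ext)
    fix i x
    obtain B B' where "\<And>x. \<bar>?v i x\<bar> \<le> B" "\<And>x. \<bar>?v (Suc i) x\<bar> \<le> B'"
      using v unfolding smooth_bounded_def by blast
    moreover have "continuous_on UNIV (?v (Suc i))"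
      using v unfolding smooth_bounded_def by (meson DERIV_isCont continuous_at_imp_continuous_on)
    ultimately show "exp_avgs \<delta> (Suc n) (u i) x + \<delta> n * exp_avgs \<delta> (Suc n) (u (Suc i)) x = ?v i x"
      using v unfolding exp_avgs.simps smooth_bounded_def by (intro exp_avg_add_deriv) auto
  qed
  finally show ?case by (rule Suc.IH)
qed simp

lemma shift_bounded_exp_avgs:
  assumes "smooth_bounded u" "shift_bounded (u 0) C"
  shows "shift_bounded (exp_avgs \<delta> n (u 0)) C"
  by (induction n) (auto intro!: shift_bounded_exp_avg exp_avgs_measurable assms)

lemma
  assumes u: "smooth_bounded u" and int: "integrable lborel (u 0)"
  shows integrable_exp_avgs: "integrable lborel (exp_avgs \<delta> n (u 0))"
    and fourier_exp_avgs: "fourier (exp_avgs \<delta> n (u 0)) \<xi> =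
      (\<Prod>j<n. inverse (1 + 2 * pi * \<i> * complex_of_real (\<delta> j * \<xi>))) * fourier (u 0) \<xi>"
proof -
  show int': "integrable lborel (exp_avgs \<delta> n (u 0))" for n
    by (induction n) (auto intro!: int integrable_lborel_exp_avg exp_avgs_measurable u)
  show "fourier (exp_avgs \<delta> n (u 0)) \<xi> =
      (\<Prod>j<n. inverse (1 + 2 * pi * \<i> * complex_of_real (\<delta> j * \<xi>))) * fourier (u 0) \<xi>"
  proof (induction n)
    case (Suc n)
    show ?case
      unfolding exp_avgs.simps fourier_exp_avg[OF exp_avgs_measurable[OF u] int'] Suc by simp
  qed simp
qed

lemma exp_avgs_infsum:
  assumes u: "smooth_bounded u" "shift_bounded (u 0) C" and c: "\<And>k. \<bar>c k\<bar> \<le> B"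
  shows "exp_avgs \<delta> n (\<lambda>x. \<Sum>\<^sub>\<infinity>k. c k * u 0 (x - real_of_int k)) =
    (\<lambda>x. \<Sum>\<^sub>\<infinity>k. c k * exp_avgs \<delta> n (u 0) (x - real_of_int k))"
proof (induction n)
  case (Suc n)
  show ?case
    unfolding exp_avgs.simps Suc
    by (rule ext, rule exp_avg_infsum[OF exp_avgs_measurable[OF u(1)] shift_bounded_exp_avgs[OF u] c])
qed simp

lemma gauss_smooth_shift_bounded:
  assumes "a > 0" "A > 0"
  obtains u C where "smooth_bounded u" "u 0 = (\<lambda>x. A * exp (- a * x\<^sup>2))" "shift_bounded (u 0) C"
proof -
  \<comment> \<open>A single Gaussian is the series whose only nonzero coefficient is
    \<open>A\<close> at k = 0, so smoothness follows from the result on series.\<close>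
  have A: "\<bar>if k = 0 then A else 0\<bar> \<le> A" for k :: int using assms(2) by simp
  obtain u where u: "smooth_bounded u"
    "u 0 = (\<lambda>x. \<Sum>\<^sub>\<infinity>k. (if k = 0 then A else 0) * exp (- a * (x - real_of_int k)\<^sup>2))"
    by (rule gauss_series_smooth_bounded[OF assms(1) A])
  have u0: "u 0 = (\<lambda>x. A * exp (- a * x\<^sup>2))"
    unfolding u(2) by (intro ext infsumI has_sum_finite_neutralI[of "{0}"]) auto
  obtain \<Theta> where \<Theta>: "\<And>x. (\<Sum>\<^sub>\<infinity>k::int. exp (- a * (x - real_of_int k)\<^sup>2)) \<le> \<Theta>"
    using infsum_gauss_shifts_bounded[OF assms(1)] by blast
  have "shift_bounded (u 0) (A * \<Theta>)"
    unfolding shift_bounded_def u0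
  proof (intro conjI allI impI)
    fix x and F :: "int set" assume "finite F"
    then have "(\<Sum>k\<in>F. exp (- a * (x - real_of_int k)\<^sup>2)) \<le> (\<Sum>\<^sub>\<infinity>k. exp (- a * (x - real_of_int k)\<^sup>2))"
      by (intro finite_sum_le_infsum summable_on_gauss_shifts assms(1)) auto
    also note \<Theta>
    finally show "(\<Sum>k\<in>F. A * exp (- a * (x - real_of_int k)\<^sup>2)) \<le> A * \<Theta>"
      using assms(2) by (simp flip: sum_distrib_left)
  qed (use assms(2) in auto)
  with u(1) u0 show ?thesis by (rule that)
qed

text \<open>The averaged Gaussian has the prescribed Fourier transform, and both functions are
  continuous and integrable, so uniqueness gives equality everywhere and not only almost
  everywhere.\<close>

lemma TP_gaussian_type_eq_exp_avgs:
  assumes "TP_gaussian_type g"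
  obtains n \<delta> a A where "a > 0" "A > 0" "g = exp_avgs \<delta> n (\<lambda>x. A * exp (- a * x\<^sup>2))"
proof -
  obtain n :: nat and \<delta> :: "nat \<Rightarrow> real" and c :: real where cont: "continuous_on UNIV g" and int: "integrable lborel g" and c: "c > 0"
    and F: "\<And>\<xi>. fourier g \<xi> = (\<Prod>j<n. inverse (1 + 2 * pi * \<i> * complex_of_real (\<delta> j * \<xi>)))
           * complex_of_real (exp (- c * \<xi>\<^sup>2))"
    using assms unfolding TP_gaussian_type_def by blast
  define a where "a = pi\<^sup>2 / c"
  define A where "A = sqrt (pi / c)"
  have aA: "a > 0" "A > 0" using c by (auto simp: a_def A_def)
  obtain u C where u: "smooth_bounded u" "u 0 = (\<lambda>x. A * exp (- a * x\<^sup>2))"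
    by (rule gauss_smooth_shift_bounded[OF aA])
  define \<gamma> where "\<gamma> = exp_avgs \<delta> n (u 0)"
  have u_int: "integrable lborel (u 0)" and u_F: "\<And>\<xi>. fourier (u 0) \<xi> = complex_of_real (exp (- c * \<xi>\<^sup>2))"
    unfolding u(2) a_def A_def using integrable_gauss[OF c] fourier_gauss[OF c] by auto
  have \<gamma>_int: "integrable lborel \<gamma>" unfolding \<gamma>_def by (rule integrable_exp_avgs[OF u(1) u_int])
  have \<gamma>_F: "fourier \<gamma> \<xi> = fourier g \<xi>" for \<xi>
    unfolding \<gamma>_def fourier_exp_avgs[OF u(1) u_int] u_F F ..
  have \<gamma>_cont: "continuous_on UNIV \<gamma>"
    using smooth_bounded_exp_avgs[OF u(1)] unfolding \<gamma>_def smooth_bounded_def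
    by (meson DERIV_isCont continuous_at_imp_continuous_on)
  have int_cis: "integrable lborel (\<lambda>x. complex_of_real (q x) * cis (- 2 * pi * x * \<xi>))"
    if q: "continuous_on UNIV q" "integrable lborel q" for q \<xi>
  proof -
    have [measurable]: "q \<in> borel_measurable borel" using q(1) by (rule borel_measurable_continuous_onI)
    show ?thesis
      by (rule Bochner_Integration.integrable_bound[OF q(2)]) (auto simp: norm_mult)
  qed
  have "g x - \<gamma> x = 0" for x
  proof (rule fourier_eq_0_imp_eq_0[of "\<lambda>x. g x - \<gamma> x"])
    show "continuous_on UNIV (\<lambda>x. g x - \<gamma> x)" by (intro continuous_intros cont \<gamma>_cont)
    show "integrable lborel (\<lambda>x. g x - \<gamma> x)" by (intro Bochner_Integration.integrable_diff int \<gamma>_int)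
    fix \<xi>
    have "fourier (\<lambda>x. g x - \<gamma> x) \<xi> = fourier g \<xi> - fourier \<gamma> \<xi>"
      unfolding fourier_def of_real_diff left_diff_distrib
      by (intro Bochner_Integration.integral_diff int_cis cont \<gamma>_cont int \<gamma>_int)
    then show "fourier (\<lambda>x. g x - \<gamma> x) \<xi> = 0" by (simp add: \<gamma>_F)
  qed
  then have "g = \<gamma>" by (auto simp: fun_eq_iff)
  then show ?thesis using that[OF aA] unfolding \<gamma>_def u(2) by blast
qed

lemma smooth_bounded_iterated_deriv:
  assumes "smooth_bounded u"
  shows "(deriv ^^ i) (u 0) = u i"
proof (induction i)
  case (Suc i)
  have "deriv (u i) = u (Suc i)"
    using assms by (intro ext DERIV_imp_deriv) (simp add: smooth_bounded_def)
  then show ?case by (simp add: Suc)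
qed simp

lemma TP_gaussian_type_shift_bounded:
  assumes "TP_gaussian_type g"
  obtains C where "shift_bounded g C"
proof -
  obtain n \<delta> a A where g: "a > 0" "A > 0" "g = exp_avgs \<delta> n (\<lambda>x. A * exp (- a * x\<^sup>2))"
    by (rule TP_gaussian_type_eq_exp_avgs[OF assms])
  obtain u C where u: "smooth_bounded u" "u 0 = (\<lambda>x. A * exp (- a * x\<^sup>2))" "shift_bounded (u 0) C"
    by (rule gauss_smooth_shift_bounded[OF g(1,2)])
  show ?thesis using that shift_bounded_exp_avgs[OF u(1,3)] unfolding g(3) u(2) by blast
qed

section \<open>Dense zeros force vanishing, and the two claims\<close>

text \<open>The set \<open>S\<close> and weight \<open>m\<close> are left abstract to serve both
  claims: \<open>m\<close> is the vanishing order in one and constantly 1 in the other.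
  \<open>f\<close> is the n-fold average of a Gaussian series \<open>u 0\<close>, which inherits
  enough zeros to vanish.\<close>

lemma real_series_dense_zeros_imp_zero:
  fixes f g :: "real \<Rightarrow> real" and c :: "int \<Rightarrow> real"
  assumes TP: "TP_gaussian_type g" and c: "\<And>k. \<bar>c k\<bar> \<le> B"
    and f: "f = (\<lambda>x. \<Sum>\<^sub>\<infinity>k. c k * g (x - real_of_int k))"
    and dens: "lower_density S m > 1"
    and zero: "\<And>y. y \<in> S \<Longrightarrow> f y = 0"
    and mult: "\<And>y i. y \<in> S \<Longrightarrow> i < m y \<Longrightarrow> (deriv ^^ i) f y = 0"
  shows "f x = 0"
proof -
  obtain n \<delta> a A where g: "a > 0" "A > 0" "g = exp_avgs \<delta> n (\<lambda>x. A * exp (- a * x\<^sup>2))"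
    by (rule TP_gaussian_type_eq_exp_avgs[OF TP])
  obtain v C where v: "smooth_bounded v" "v 0 = (\<lambda>x. A * exp (- a * x\<^sup>2))" "shift_bounded (v 0) C"
    by (rule gauss_smooth_shift_bounded[OF g(1,2)])
  have cA: "\<bar>c k * A\<bar> \<le> B * A" for k using c[of k] g(2) by (simp add: abs_mult mult_right_mono)
  obtain u where u: "smooth_bounded u"
    "u 0 = (\<lambda>x. \<Sum>\<^sub>\<infinity>k. c k * A * exp (- a * (x - real_of_int k)\<^sup>2))"
    by (rule gauss_series_smooth_bounded[OF g(1) cA])
  let ?U = "\<lambda>i. exp_avgs \<delta> n (u i)"
  have U: "smooth_bounded ?U" by (rule smooth_bounded_exp_avgs[OF u(1)])
  have "u 0 = (\<lambda>x. \<Sum>\<^sub>\<infinity>k. c k * v 0 (x - real_of_int k))"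
    unfolding u(2) v(2) by (simp add: mult.assoc)
  then have fU: "f = ?U 0"
    using exp_avgs_infsum[OF v(1,3) c, of \<delta> n] by (simp add: f g(3) v(2))
  \<comment> \<open>The n additional zeros are those lost on the way from \<open>f\<close> back to
    \<open>u 0\<close>.\<close>
  obtain r M where rM: "r > 0" "real M > 2 * r + 1" "\<And>x. has_zeros ?U (M + n) {x - r..x + r}"
  proof (rule lower_density_gt_1_has_zeros[OF dens, where u = ?U and d = n])
    show "?U 0 y = 0" if "y \<in> S" for y using zero[OF that] by (simp add: fU)
    show "?U i y = 0" if "y \<in> S" "i < m y" for y i
      using mult[OF that] smooth_bounded_iterated_deriv[OF U, of i] by (simp add: fU)
  qed (rule that)
  have "has_zeros u M {x - r..x + r}" for x
    using rM(3) by (rule has_zeros_exp_avgs[OF u(1)])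
  then have "u 0 = (\<lambda>x. 0)"
    using gauss_series_vanish[OF g(1) cA u rM(1,2)] by blast
  then show ?thesis by (simp add: fU exp_avgs_zero)
qed

text \<open>As \<open>g\<close> is real, taking real and imaginary parts acts on the coefficients
  only; this reduces complex functions to real series.\<close>

lemma V_infty_Re_Im:
  assumes TP: "TP_gaussian_type g" and f: "f \<in> V_infty g"
  obtains B c c' where "\<And>k. \<bar>c k\<bar> \<le> B" "\<And>k. \<bar>c' k\<bar> \<le> B"
    "(\<lambda>x. Re (f x)) = (\<lambda>x. \<Sum>\<^sub>\<infinity>k. c k * g (x - real_of_int k))"
    "(\<lambda>x. Im (f x)) = (\<lambda>x. \<Sum>\<^sub>\<infinity>k. c' k * g (x - real_of_int k))"
proof -
  obtain c where "bounded (range c)"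
    and fc: "\<And>x. f x = (\<Sum>\<^sub>\<infinity>k. c k * complex_of_real (g (x - real_of_int k)))"
    using f unfolding V_infty_def by blast
  then obtain B where B: "\<And>k. norm (c k) \<le> B" by (auto simp: bounded_iff)
  obtain C where C: "shift_bounded g C" by (rule TP_gaussian_type_shift_bounded[OF TP])
  then have g0: "0 \<le> g x" for x by (simp add: shift_bounded_def)
  have sm: "(\<lambda>k. c k * complex_of_real (g (x - real_of_int k))) summable_on UNIV" for x
  proof (rule abs_summable_summable, rule Infinite_Sum.abs_summable_on_comparison_test')
    show "(\<lambda>k. B * g (x - real_of_int k)) summable_on UNIV"
      by (rule summable_on_cmult_right[OF shift_bounded_summable[OF C]])
    show "norm (c k * complex_of_real (g (x - real_of_int k))) \<le> B * g (x - real_of_int k)" for k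
      using mult_right_mono[OF B g0] by (simp add: norm_mult g0)
  qed
  show ?thesis
  proof (rule that[of "\<lambda>k. Re (c k)" B "\<lambda>k. Im (c k)"])
    show "\<bar>Re (c k)\<bar> \<le> B" "\<bar>Im (c k)\<bar> \<le> B" for k
      using B[of k] abs_Re_le_cmod[of "c k"] abs_Im_le_cmod[of "c k"] by linarith+
    show "(\<lambda>x. Re (f x)) = (\<lambda>x. \<Sum>\<^sub>\<infinity>k. Re (c k) * g (x - real_of_int k))"
      unfolding fc infsum_Re[OF sm, symmetric] by simp
    show "(\<lambda>x. Im (f x)) = (\<lambda>x. \<Sum>\<^sub>\<infinity>k. Im (c k) * g (x - real_of_int k))"
      unfolding fc infsum_Im[OF sm, symmetric] by simp
  qed
qed

theorem theorem4p9:
  fixes g :: "real \<Rightarrow> real"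
  assumes "TP_gaussian_type g"
  shows "(\<forall>f::real \<Rightarrow> real.
            (\<lambda>x. complex_of_real (f x)) \<in> V_infty g \<and> (\<exists>x. f x \<noteq> 0) \<longrightarrow>
            lower_density {x. f x = 0} (vanishing_order f) \<le> 1)
       \<and> (\<forall>\<Lambda>::real set. lower_density_set \<Lambda> > 1 \<longrightarrow>
            (\<forall>f \<in> V_infty g. (\<forall>y\<in>\<Lambda>. f y = 0) \<longrightarrow> (\<forall>x. f x = 0)))"
proof (intro conjI allI impI ballI)
  fix f :: "real \<Rightarrow> real"
  assume f: "(\<lambda>x. complex_of_real (f x)) \<in> V_infty g \<and> (\<exists>x. f x \<noteq> 0)"
  show "lower_density {x. f x = 0} (vanishing_order f) \<le> 1"
  proof (rule ccontr)
    assume "\<not> lower_density {x. f x = 0} (vanishing_order f) \<le> 1"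
    then have dens: "lower_density {x. f x = 0} (vanishing_order f) > 1" by simp
    obtain B c where c: "\<And>k. \<bar>c k\<bar> \<le> B"
      and fc: "(\<lambda>x. Re (complex_of_real (f x))) = (\<lambda>x. \<Sum>\<^sub>\<infinity>k. c k * g (x - real_of_int k))"
      by (rule V_infty_Re_Im[OF assms conjunct1[OF f]]) (rule that)
    have "f x = 0" for x
    proof (rule real_series_dense_zeros_imp_zero[OF assms c _ dens, of f])
      show "f = (\<lambda>x. \<Sum>\<^sub>\<infinity>k. c k * g (x - real_of_int k))" using fc by simp
      \<comment> \<open>Indices below a \<open>LEAST\<close> never satisfy its predicate, so this
        holds even at a point where all derivatives vanish.\<close>
      show "(deriv ^^ i) f y = 0" if "i < vanishing_order f y" for y i
        using not_less_Least[of i "\<lambda>n. (deriv ^^ n) f y \<noteq> 0"] that unfolding vanishing_order_def by blast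
    qed auto
    with f show False by blast
  qed
next
  fix \<Lambda> :: "real set" and f :: "real \<Rightarrow> complex" and x :: real
  assume dens: "lower_density_set \<Lambda> > 1" and f: "f \<in> V_infty g" and zero: "\<forall>y\<in>\<Lambda>. f y = 0"
  obtain B c c' where c: "\<And>k. \<bar>c k\<bar> \<le> B" "\<And>k. \<bar>c' k\<bar> \<le> B"
    and fc: "(\<lambda>x. Re (f x)) = (\<lambda>x. \<Sum>\<^sub>\<infinity>k. c k * g (x - real_of_int k))"
      "(\<lambda>x. Im (f x)) = (\<lambda>x. \<Sum>\<^sub>\<infinity>k. c' k * g (x - real_of_int k))"
    by (rule V_infty_Re_Im[OF assms f]) (rule that)
  \<comment> \<open>With weight 1 only i = 0 occurs, so vanishing of the real part on \<Lambda> is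
    all that is asked.\<close>
  have "Re (f x) = 0"
    by (rule real_series_dense_zeros_imp_zero[OF assms c(1) fc(1) dens[unfolded lower_density_set_def]])
       (use zero in auto)
  moreover have "Im (f x) = 0"
    by (rule real_series_dense_zeros_imp_zero[OF assms c(2) fc(2) dens[unfolded lower_density_set_def]])
       (use zero in auto)
  ultimately show "f x = 0" by (simp add: complex_eq_iff)
qed

end
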